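(* For every finite set $A\subset\mathbb{R}$, $$|A(A+A)|\gtrapprox |A|^{\frac{3}{2}+\frac{1}{178}},$$ where $A(A+A)=\{a(b+c): a,b,c\in A\}$.
   Context: For positive quantities $X,Y$, the notation $X\gtrapprox Y$ means that there exist absolute positive constants $C$ and $c$ such that $X\geq c\,Y/(\log X)^C$. All logarithms are to base 2. *)

theory Defs
  imports Complex_Main
begin

definition prod_sum_set :: "real set \<Rightarrow> real set" where
  "prod_sum_set A = {a * (b + c) | a b c. a \<in> A \<and> b \<in> A \<and> c \<in> A}"

end

(* An upper bound for s = |A(A+A)| bounds below the number of solutions of a(b+c) = a'(b'+c'),
   that is of t(b+c) = b'+c' with t = a/a'.  The ratios t can be taken from a set T of popular
   ratios, and Szemeredi-Trotter bounds the number of solutions with t in a given T, so T is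
   rich: about |A| ratios with about |A| representations each, up to the excess of s over
   |A|^(3/2).  Then many elements b of a subset B of A have many quotients b/a in T, and each
   difference b - c = (b/a) a - c gives many incidences of the points A x D with the lines
   T x C.  So Szemeredi-Trotter bounds the number of popular differences of B - C for every C,
   as it does for sets with few products.  The Schoen-Shkredov-Li argument for such sets makes
   |B+B| larger than |A|^(3/2) by a power, while |B+B| <= s.
   All point sets that occur are Cartesian products.  For these Szemeredi-Trotter is elementary:
   along a line most pairs of consecutive points are close in both coordinate orders, and a
   pair of points lies on at most one line.  The method gives the exponent 44/29 > 3/2 + 1/178. *)

theory Submission
  imports Defs "HOL-Analysis.Convex"
begin

section \<open>Szemeredi--Trotter for Cartesian products\<close>

text \<open>The count \<open>card (X \<inter> {x..<x'})\<close> is the rank difference of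
  \<open>x\<close> and \<open>x'\<close>. For fixed \<open>x\<close> it is injective in
  \<open>x'\<close> with positive integer values, so at most \<open>u\<close> partners are
  close.\<close>

lemma card_close_pairs_le:
  fixes X :: "'a::linorder set" and u :: real
  assumes fin: "finite X" and u: "u \<ge> 0"
  shows "real (card {(x, x'). x \<in> X \<and> x' \<in> X \<and> x < x' \<and> real (card (X \<inter> {x..<x'})) \<le> u})
    \<le> real (card X) * u"
proof -
  define Q where "Q x = {x' \<in> X. x < x' \<and> real (card (X \<inter> {x..<x'})) \<le> u}" for x
  have eq: "{(x, x'). x \<in> X \<and> x' \<in> X \<and> x < x' \<and> real (card (X \<inter> {x..<x'})) \<le> u} = Sigma X Q"
    by (auto simp: Q_def)
  have "real (card (Q x)) \<le> u" if x: "x \<in> X" for x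
  proof -
    have less: "card (X \<inter> {x..<y}) < card (X \<inter> {x..<z})" if "y \<in> X" "x < y" "y < z" for y z
      using that x fin by (intro psubset_card_mono) auto
    have "inj_on (\<lambda>x'. card (X \<inter> {x..<x'})) (Q x)"
    proof (rule inj_onI)
      fix y z assume "y \<in> Q x" "z \<in> Q x" "card (X \<inter> {x..<y}) = card (X \<inter> {x..<z})"
      then show "y = z" using less[of y z] less[of z y] by (auto simp: Q_def) (metis linorder_less_linear)
    qed
    moreover have "(\<lambda>x'. card (X \<inter> {x..<x'})) ` Q x \<subseteq> {1..nat \<lfloor>u\<rfloor>}"
    proof clarify
      fix y assume y: "y \<in> Q x"
      then have "x \<in> X \<inter> {x..<y}" using x by (auto simp: Q_def)
      then have "card (X \<inter> {x..<y}) \<ge> 1" using fin by (metis One_nat_def Suc_leI card_gt_0_iff empty_iff finite_Int)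
      with y u show "card (X \<inter> {x..<y}) \<in> {1..nat \<lfloor>u\<rfloor>}" by (auto simp: Q_def le_nat_floor)
    qed
    ultimately have "card (Q x) \<le> card {1..nat \<lfloor>u\<rfloor>}" by (intro card_inj_on_le) auto
    then show ?thesis using u by (simp add: le_nat_floor) linarith
  qed
  then have "(\<Sum>x\<in>X. real (card (Q x))) \<le> (\<Sum>x\<in>X. u)" by (intro sum_mono)
  moreover have "card (Sigma X Q) = (\<Sum>x\<in>X. card (Q x))"
    using fin by (intro card_SigmaI) (auto simp: Q_def)
  ultimately show ?thesis unfolding eq by simp
qed

lemma card_Int_lessThan_split:
  fixes X :: "'a::linorder set"
  assumes "finite X" "g \<le> h"
  shows "card (X \<inter> {..<h}) = card (X \<inter> {..<g}) + card (X \<inter> {g..<h})"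
proof -
  have "card ((X \<inter> {..<g}) \<union> (X \<inter> {g..<h})) = card (X \<inter> {..<g}) + card (X \<inter> {g..<h})"
    using assms(1) by (intro card_Un_disjoint) auto
  moreover have "(X \<inter> {..<g}) \<union> (X \<inter> {g..<h}) = X \<inter> {..<h}" using assms(2) by auto
  ultimately show ?thesis by simp
qed

text \<open>Walk through \<open>H\<close> in increasing order. Two consecutive points are either
  close in both orders, or they jump over more than \<open>u\<close> points of \<open>X\<close> or
  more than \<open>v\<close> points of \<open>Y\<close>. The jumped intervals are disjoint, so at
  most |X| / u and |Y| / v jumps occur.\<close>

lemma card_le_close_pairs:
  fixes X :: "'a::linorder set" and Y :: "'b::linorder set" and u v :: real
  assumes fin: "finite X" "finite Y" and u: "u > 0" and v: "v > 0" and f: "strict_mono f"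
  defines "Q H \<equiv> {(x, x'). x \<in> H \<and> x' \<in> H \<and> x < x' \<and> real (card (X \<inter> {x..<x'})) \<le> u
      \<and> real (card (Y \<inter> {f x..<f x'})) \<le> v}"
  assumes H: "H \<subseteq> X" "f ` H \<subseteq> Y"
  shows "real (card H) \<le> real (card (Q H)) + 1 + real (card X) / u + real (card Y) / v"
proof (cases "H = {}")
  case True
  then show ?thesis using u v by simp
next
  case False
  have "finite H" using H(1) fin(1) by (rule finite_subset)
  \<comment> \<open>The induction adds a new maximum, so the claim is sharpened to count only the
    points below \<open>Max H\<close> and below \<open>f (Max H)\<close>: each step then pays only
    for the interval it crosses.\<close>
  then have "H \<subseteq> X \<Longrightarrow> f ` H \<subseteq> Y \<Longrightarrow> H \<noteq> {} \<Longrightarrow> real (card H) \<le> real (card (Q H)) + 1 +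
      real (card (X \<inter> {..<Max H})) / u + real (card (Y \<inter> {..<f (Max H)})) / v"
  proof (induction H rule: finite_linorder_max_induct)
    case empty
    then show ?case by simp
  next
    case (insert h H)
    show ?case
    proof (cases "H = {}")
      case True
      then show ?thesis using u v by simp
    next
      case False
      define g where "g = Max H"
      have g: "g \<in> H" "g < h" using False insert.hyps by (auto simp: g_def)
      have M: "Max (insert h H) = h" using insert.hyps by (intro Max_eqI) (auto intro: less_imp_le)
      have fQ: "finite (Q (insert h H))"
        by (rule finite_subset[of _ "insert h H \<times> insert h H"]) (use insert.hyps in \<open>auto simp: Q_def\<close>)
      have sub: "Q H \<subseteq> Q (insert h H)" by (auto simp: Q_def)
      have hH: "h \<notin> H" using insert.hyps by auto
      have IH: "real (card H) \<le> real (card (Q H)) + 1 +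
        real (card (X \<inter> {..<g})) / u + real (card (Y \<inter> {..<f g})) / v"
        using insert False by (auto simp: g_def)
      have fgh: "f g < f h" using f g by (auto simp: strict_mono_def)
      have cX: "card (X \<inter> {..<h}) = card (X \<inter> {..<g}) + card (X \<inter> {g..<h})"
        using fin g by (intro card_Int_lessThan_split) auto
      have cY: "card (Y \<inter> {..<f h}) = card (Y \<inter> {..<f g}) + card (Y \<inter> {f g..<f h})"
        using fin fgh by (intro card_Int_lessThan_split) auto
      \<comment> \<open>Only the pair of the old maximum \<open>g\<close> and the new one
        \<open>h\<close> matters: it is a new close pair unless one of its two gaps is
        large.\<close>
      have "card (Q H) + 1 \<le> card (Q (insert h H)) \<or>
         real (card (X \<inter> {g..<h})) > u \<or> real (card (Y \<inter> {f g..<f h})) > v"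
      proof -
        have "card (Q H) + 1 \<le> card (Q (insert h H))" if "(g,h) \<in> Q (insert h H)"
        proof -
          have "(g,h) \<notin> Q H" using hH by (auto simp: Q_def)
          then have "card (Q H) < card (Q (insert h H))" using that sub fQ by (intro psubset_card_mono) auto
          then show ?thesis by simp
        qed
        moreover have "(g,h) \<in> Q (insert h H) \<or> real (card (X \<inter> {g..<h})) > u
            \<or> real (card (Y \<inter> {f g..<f h})) > v"
          using g by (simp add: Q_def not_less[symmetric]) blast
        ultimately show ?thesis by blast
      qed
      moreover have "card (Q H) \<le> card (Q (insert h H))" using sub fQ by (rule card_mono[rotated])
      moreover have "real (card (X \<inter> {g..<h})) > u \<Longrightarrow> real (card (X \<inter> {g..<h})) / u \<ge> 1"
        using u by simp
      moreover have "real (card (Y \<inter> {f g..<f h})) > v \<Longrightarrow> real (card (Y \<inter> {f g..<f h})) / v \<ge> 1"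
        using v by simp
      moreover have "real (card (X \<inter> {g..<h})) / u \<ge> 0" "real (card (Y \<inter> {f g..<f h})) / v \<ge> 0"
        using u v by simp_all
      moreover have "card (insert h H) = card H + 1" using hH insert.hyps(1) by simp
      ultimately have "real (card (insert h H)) \<le> real (card (Q (insert h H))) + 1 +
          (real (card (X \<inter> {..<g})) / u + real (card (X \<inter> {g..<h})) / u) +
          (real (card (Y \<inter> {..<f g})) / v + real (card (Y \<inter> {f g..<f h})) / v)"
        using IH by linarith
      then show ?thesis unfolding M cX cY by (simp only: add_divide_distrib of_nat_add)
    qed
  qed
  then have "real (card H) \<le> real (card (Q H)) + 1 +
      real (card (X \<inter> {..<Max H})) / u + real (card (Y \<inter> {..<f (Max H)})) / v"
    using H False by auto
  moreover have "real (card (X \<inter> {..<Max H})) / u \<le> real (card X) / u"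
    using u fin by (intro divide_right_mono) (auto intro: card_mono)
  moreover have "real (card (Y \<inter> {..<f (Max H)})) / v \<le> real (card Y) / v"
    using v fin by (intro divide_right_mono) (auto intro: card_mono)
  ultimately show ?thesis by linarith
qed

text \<open>The close pairs of all lines are counted together, since a pair of points lies on at
  most one line; every line has at most 1 + 2 s more points than close pairs. Positive slopes make
  the lines order-preserving, as the close-pair count requires.\<close>

lemma incidences_le:
  fixes X Y :: "real set" and L :: "(real \<times> real) set" and s :: real
  assumes fin: "finite X" "finite Y" "finite L" and pos: "\<And>t b. (t, b) \<in> L \<Longrightarrow> t > 0" and s: "s > 0"
  shows "(\<Sum>(t, b)\<in>L. real (card {x \<in> X. t * x + b \<in> Y}))
    \<le> real (card L) * (1 + 2 * s) + (real (card X) * real (card Y))\<^sup>2 / s\<^sup>2"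
proof (cases "X = {} \<or> Y = {}")
  case True
  then have "(\<Sum>(t, b)\<in>L. real (card {x \<in> X. t * x + b \<in> Y})) = 0"
    by (intro sum.neutral) auto
  then show ?thesis using s by simp
next
  case False
  \<comment> \<open>These cutoffs make |X| / u and |Y| / v both equal to \<open>s\<close>, and the
    product of the two close-pair bounds equal to the last term of the claim.\<close>
  define u v where "u = real (card X) / s" and "v = real (card Y) / s"
  have cX: "card X > 0" "card Y > 0" using False fin by (auto simp: card_gt_0_iff)
  then have u: "u > 0" "v > 0" using s by (auto simp: u_def v_def)
  define Q where "Q = (\<lambda>(t, b). {(x, x'). x \<in> {x\<in>X. t * x + b \<in> Y} \<and> x' \<in> {x\<in>X. t * x + b \<in> Y} \<and> x < x' \<and>
     real (card (X \<inter> {x..<x'})) \<le> u \<and> real (card (Y \<inter> {t * x + b..<t * x' + b})) \<le> v})"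
  define PX where "PX = {(x, x'). x \<in> X \<and> x' \<in> X \<and> x < x' \<and> real (card (X \<inter> {x..<x'})) \<le> u}"
  define PY where "PY = {(x, x'). x \<in> Y \<and> x' \<in> Y \<and> x < x' \<and> real (card (Y \<inter> {x..<x'})) \<le> v}"
  have fP: "finite PX" "finite PY"
    by (rule finite_subset[of _ "X \<times> X"] finite_subset[of _ "Y \<times> Y"]; use fin in \<open>auto simp: PX_def PY_def\<close>)+
  have fQ: "finite (Q l)" for l
    by (rule finite_subset[of _ "X \<times> X"]) (use fin in \<open>auto simp: Q_def split: prod.splits\<close>)
  have "real (card {x \<in> X. t * x + b \<in> Y}) \<le> real (card (Q (t, b))) + (1 + 2 * s)" if "(t, b) \<in> L" for t b
  proof -
    have "strict_mono (\<lambda>x. t * x + b)" using pos[OF that] by (auto simp: strict_mono_def)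
    from card_le_close_pairs[OF fin(1,2) u this, of "{x \<in> X. t * x + b \<in> Y}"]
    have "real (card {x \<in> X. t * x + b \<in> Y}) \<le> real (card (Q (t, b))) + 1
       + real (card X) / u + real (card Y) / v"
      by (auto simp: Q_def)
    moreover have "real (card X) / u = s" "real (card Y) / v = s"
      using cX s by (auto simp: u_def v_def)
    ultimately show ?thesis by simp
  qed
  then have "(\<Sum>(t, b)\<in>L. real (card {x \<in> X. t * x + b \<in> Y})) \<le> (\<Sum>l\<in>L. real (card (Q l)) + (1 + 2 * s))"
    by (intro sum_mono) auto
  also have "\<dots> = real (card (Sigma L Q)) + real (card L) * (1 + 2 * s)"
    using fin fQ by (simp add: card_SigmaI sum.distrib)
  also have "card (Sigma L Q) \<le> card (PX \<times> PY)"
  proof (rule card_inj_on_le)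
    \<comment> \<open>The points of the line over \<open>x\<close> and \<open>x'\<close> have
      distinct abscissas, so they determine slope and intercept.\<close>
    let ?g = "\<lambda>((t, b), (x, x')). ((x, x'), (t * x + b, t * x' + b))"
    show "inj_on ?g (Sigma L Q)"
    proof (rule inj_onI)
      fix p q assume "p \<in> Sigma L Q" "q \<in> Sigma L Q" and eq: "?g p = ?g q"
      obtain t b x x' t' b' y y' where pq: "p = ((t, b), (x, x'))" "q = ((t', b'), (y, y'))"
        by (metis surj_pair)
      have "x < x'" using \<open>p \<in> _\<close> pq by (auto simp: Q_def)
      have e: "y = x" "y' = x'" "t * x + b = t' * x + b'" "t * x' + b = t' * x' + b'"
        using eq pq by auto
      then have "(t - t') * (x - x') = 0" by (simp add: algebra_simps)
      with \<open>x < x'\<close> have "t = t'" by simp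
      with e pq show "p = q" by simp
    qed
    show "?g ` Sigma L Q \<subseteq> PX \<times> PY"
      using pos by (auto simp: Q_def PX_def PY_def)
  qed (use fP in auto)
  then have "real (card (Sigma L Q)) \<le> real (card PX) * real (card PY)"
    by (metis card_cartesian_product of_nat_le_iff of_nat_mult)
  also have "\<dots> \<le> (real (card X) * u) * (real (card Y) * v)"
    unfolding PX_def PY_def using fin u by (intro mult_mono card_close_pairs_le) auto
  also have "\<dots> = (real (card X) * real (card Y))\<^sup>2 / s\<^sup>2"
    by (simp add: u_def v_def power2_eq_square)
  finally show ?thesis by simp
qed

text \<open>The parameter s is chosen so that the term 2 s |L| is half of the incidences.\<close>

lemma szemeredi_trotter_grid:
  fixes X Y :: "real set" and L :: "(real \<times> real) set"
  assumes fin: "finite X" "finite Y" "finite L" and pos: "\<And>t b. (t, b) \<in> L \<Longrightarrow> t > 0"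
  defines "I \<equiv> \<Sum>(t, b)\<in>L. real (card {x \<in> X. t * x + b \<in> Y})"
  shows "I \<le> 4 * real (card L) \<or> I ^ 3 \<le> 64 * (real (card X) * real (card Y))\<^sup>2 * (real (card L))\<^sup>2"
proof (rule disjCI)
  assume "\<not> I ^ 3 \<le> 64 * (real (card X) * real (card Y))\<^sup>2 * (real (card L))\<^sup>2"
  then have I3: "I ^ 3 > 64 * (real (card X) * real (card Y))\<^sup>2 * (real (card L))\<^sup>2" by simp
  show "I \<le> 4 * real (card L)"
  proof (rule ccontr)
    assume I: "\<not> I \<le> 4 * real (card L)"
    have "L \<noteq> {}" using I by (auto simp: I_def)
    then have L: "real (card L) > 0" using fin by (simp add: card_gt_0_iff)
    then have Ip: "I > 0" using I by linarith
    define s where "s = I / (4 * real (card L))"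
    have "I \<le> real (card L) * (1 + 2 * s) + (real (card X) * real (card Y))\<^sup>2 / s\<^sup>2"
      unfolding I_def using fin pos Ip L by (intro incidences_le) (auto simp: s_def)
    also have "real (card L) * (1 + 2 * s) = real (card L) + I / 2"
      using L by (simp add: s_def field_simps)
    also have "(real (card X) * real (card Y))\<^sup>2 / s\<^sup>2
        = 16 * (real (card X) * real (card Y))\<^sup>2 * (real (card L))\<^sup>2 / I\<^sup>2"
      by (simp add: s_def power_divide power_mult_distrib)
    \<comment> \<open>This is exactly the failure of the cubic bound. With |L| < I / 4 the three
      terms add up to less than \<open>I\<close>.\<close>
    also have "\<dots> < I / 4"
      using I3 Ip by (simp add: field_simps power2_eq_square power3_eq_cube)
    finally show False using I by simp
  qed
qed

section \<open>Moments of fibre cardinalities\<close>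

text \<open>The representation function: for a sum, difference or quotient map on a product set it
  counts the representations of \<open>v\<close>, and its second moment is the corresponding
  energy.\<close>

definition fibre_card :: "('a \<Rightarrow> 'b) \<Rightarrow> 'a set \<Rightarrow> 'b \<Rightarrow> nat"
  where "fibre_card f X v = card {x \<in> X. f x = v}"

lemma fibre_card_pos: "finite X \<Longrightarrow> v \<in> f ` X \<Longrightarrow> 1 \<le> fibre_card f X v"
  by (auto simp: fibre_card_def Suc_le_eq card_gt_0_iff)

lemma fibre_card_le_card: "finite X \<Longrightarrow> fibre_card f X v \<le> card X"
  by (auto simp: fibre_card_def intro: card_mono)

lemma sum_comp_eq_sum_fibre_card:
  fixes h :: "'b \<Rightarrow> real"
  assumes "finite X"
  shows "(\<Sum>x\<in>X. h (f x)) = (\<Sum>v\<in>f ` X. real (fibre_card f X v) * h v)"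
proof -
  have "(\<Sum>x\<in>X. h (f x)) = (\<Sum>v\<in>f ` X. \<Sum>x\<in>{x \<in> X. f x = v}. h (f x))"
    using assms by (rule sum.image_gen)
  also have "\<dots> = (\<Sum>v\<in>f ` X. real (fibre_card f X v) * h v)"
    by (intro sum.cong) (auto simp: fibre_card_def)
  finally show ?thesis .
qed

lemma sum_fibre_card: "finite X \<Longrightarrow> (\<Sum>v\<in>f ` X. real (fibre_card f X v)) = real (card X)"
  using sum_comp_eq_sum_fibre_card[of X "\<lambda>_. 1" f] by simp

lemma sum_fibre_card_square:
  assumes "finite X"
  shows "(\<Sum>v\<in>f ` X. (real (fibre_card f X v))\<^sup>2) = (\<Sum>x\<in>X. real (fibre_card f X (f x)))"
  by (simp add: sum_comp_eq_sum_fibre_card[OF assms, of "\<lambda>v. real (fibre_card f X v)"] power2_eq_square)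

lemma sum_fibre_card_square_eq_card:
  assumes "finite X"
  shows "(\<Sum>v\<in>f ` X. (real (fibre_card f X v))\<^sup>2) = real (card {(p, q). p \<in> X \<and> q \<in> X \<and> f p = f q})"
proof -
  have eq: "{(p, q). p \<in> X \<and> q \<in> X \<and> f p = f q} = Sigma X (\<lambda>p. {q \<in> X. f q = f p})" by auto
  show ?thesis
    unfolding eq sum_fibre_card_square[OF assms] using assms by (subst card_SigmaI) (auto simp: fibre_card_def)
qed

lemma sum_fibre_card_cube:
  assumes "finite X"
  shows "(\<Sum>v\<in>f ` X. (real (fibre_card f X v)) ^ 3)
    = real (card {(p, q, r). p \<in> X \<and> q \<in> X \<and> r \<in> X \<and> f p = f q \<and> f p = f r})"
proof -
  have eq: "{(p, q, r). p \<in> X \<and> q \<in> X \<and> r \<in> X \<and> f p = f q \<and> f p = f r}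
      = Sigma X (\<lambda>p. {q \<in> X. f q = f p} \<times> {q \<in> X. f q = f p})" by auto
  have "(\<Sum>v\<in>f ` X. (real (fibre_card f X v)) ^ 3) = (\<Sum>x\<in>X. (real (fibre_card f X (f x)))\<^sup>2)"
    unfolding sum_comp_eq_sum_fibre_card[OF assms, of "\<lambda>v. (real (fibre_card f X v))\<^sup>2"]
    by (simp add: power2_eq_square power3_eq_cube mult.assoc)
  also have "\<dots> = real (card {(p, q, r). p \<in> X \<and> q \<in> X \<and> r \<in> X \<and> f p = f q \<and> f p = f r})"
    unfolding eq using assms
    by (subst card_SigmaI) (auto simp: fibre_card_def card_cartesian_product power2_eq_square)
  finally show ?thesis .
qed

lemma card_square_le_energy:
  assumes "finite X"
  shows "(real (card X))\<^sup>2 \<le> real (card (f ` X)) * (\<Sum>v\<in>f ` X. (real (fibre_card f X v))\<^sup>2)"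
  using Cauchy_Schwarz_ineq_sum[of "\<lambda>_. 1" "\<lambda>v. real (fibre_card f X v)" "f ` X"] sum_fibre_card[OF assms, of f]
  by simp

section \<open>Dyadic pigeonholing\<close>

text \<open>The values of \<open>n\<close> fall into \<open>m\<close> dyadic levels, and the level
  with the largest sum carries at least the average.\<close>

lemma dyadic_pigeonhole:
  fixes n :: "'a \<Rightarrow> nat" and g :: "'a \<Rightarrow> real"
  assumes fin: "finite X" and n: "\<And>x. x \<in> X \<Longrightarrow> 1 \<le> n x" "\<And>x. x \<in> X \<Longrightarrow> n x < 2 ^ m"
    and m: "m > 0"
  shows "\<exists>j. (\<Sum>x\<in>X. g x) \<le> real m * (\<Sum>x | x \<in> X \<and> 2 ^ j \<le> n x \<and> n x < 2 * 2 ^ j. g x)"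
proof -
  \<comment> \<open>\<open>c x\<close> is the integer part of the binary logarithm of
    \<open>n x\<close>.\<close>
  define c where "c x = (LEAST j. n x < 2 ^ (j + 1))" for x
  have c1: "n x < 2 ^ (c x + 1)" and c2: "2 ^ c x \<le> n x" and c3: "c x < m" if x: "x \<in> X" for x
  proof -
    have *: "n x < 2 ^ ((m - 1) + 1)" using n(2)[OF x] m by simp
    show "n x < 2 ^ (c x + 1)" unfolding c_def using * by (rule LeastI)
    have "c x \<le> m - 1" unfolding c_def using * by (rule Least_le)
    then show "c x < m" using m by simp
    show "2 ^ c x \<le> n x"
    proof (cases "c x")
      case 0
      then show ?thesis using n(1)[OF x] by simp
    next
      case (Suc j)
      then have "\<not> n x < 2 ^ (j + 1)" unfolding c_def by (intro not_less_Least) simp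
      then show ?thesis using Suc by simp
    qed
  qed
  have cl: "{x \<in> X. 2 ^ j \<le> n x \<and> n x < 2 * 2 ^ j} = {x \<in> X. c x = j}" for j
  proof -
    have 1: "c x = j" if "x \<in> X" "2 ^ j \<le> n x" "n x < 2 * 2 ^ j" for x
    proof -
      have less: "a < b" if "(2::nat) ^ a < 2 ^ b" for a b :: nat using that by simp
      have "j < c x + 1" by (rule less) (use c1[OF that(1)] that(2) in simp)
      moreover have "c x < j + 1" by (rule less) (use c2[OF that(1)] that(3) in simp)
      ultimately show ?thesis by simp
    qed
    have 2: "2 ^ j \<le> n x" "n x < 2 * 2 ^ j" if "x \<in> X" "c x = j" for x
      using c1[OF that(1)] c2[OF that(1)] that(2) by simp_all
    show ?thesis using 1 2 by blast
  qed
  define G where "G j = (\<Sum>x | x \<in> X \<and> c x = j. g x)" for j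
  have tot: "(\<Sum>x\<in>X. g x) = (\<Sum>j<m. G j)"
    unfolding G_def using fin c3 by (intro sum.group[symmetric]) auto
  have "Max (G ` {..<m}) \<in> G ` {..<m}" using m by (intro Max_in) auto
  then obtain j where j: "G j = Max (G ` {..<m})" by auto
  have "(\<Sum>j<m. G j) \<le> (\<Sum>i<m. G j)" unfolding j by (intro sum_mono) auto
  then show ?thesis unfolding tot by (intro exI[of _ j]) (simp add: cl G_def)
qed

section \<open>Moments of functions whose level sets obey a Szemeredi-Trotter bound\<close>

context
  fixes f :: "'a \<Rightarrow> 'b" and X :: "'a set" and m :: nat and M :: real
  assumes fin: "finite X" and bound: "card X < 2 ^ m"
    and rich: "\<And>k. 1 \<le> k \<Longrightarrow> real (card {v \<in> f ` X. k \<le> fibre_card f X v}) * real k ^ 3 \<le> M"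
begin

lemma moment_dyadic:
  obtains k :: nat where "1 \<le> k" "(\<Sum>v\<in>f ` X. real (fibre_card f X v) ^ e) \<le>
    real m * (\<Sum>v | v \<in> f ` X \<and> k \<le> fibre_card f X v \<and> fibre_card f X v < 2 * k. real (fibre_card f X v) ^ e)"
proof (cases "m = 0")
  case True
  then have "X = {}" using bound fin by simp
  then show ?thesis by (intro that[of 1]) simp_all
next
  case False
  then have "\<exists>j. (\<Sum>v\<in>f ` X. real (fibre_card f X v) ^ e) \<le> real m *
    (\<Sum>v | v \<in> f ` X \<and> 2 ^ j \<le> fibre_card f X v \<and> fibre_card f X v < 2 * 2 ^ j. real (fibre_card f X v) ^ e)"
  proof (intro dyadic_pigeonhole)
    show "finite (f ` X)" using fin by simp
    show "1 \<le> fibre_card f X v" if "v \<in> f ` X" for v using fin that by (rule fibre_card_pos)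
    show "fibre_card f X v < 2 ^ m" for v using fibre_card_le_card[OF fin] bound by (rule le_less_trans)
  qed simp
  then obtain j where "(\<Sum>v\<in>f ` X. real (fibre_card f X v) ^ e) \<le> real m *
    (\<Sum>v | v \<in> f ` X \<and> 2 ^ j \<le> fibre_card f X v \<and> fibre_card f X v < 2 * 2 ^ j. real (fibre_card f X v) ^ e)" ..
  then show ?thesis by (rule that[of "2 ^ j", rotated]) simp
qed

lemma card_dyadic_le:
  assumes "1 \<le> k"
  shows "real (card {v \<in> f ` X. k \<le> fibre_card f X v \<and> fibre_card f X v < 2 * k}) * real k ^ 3 \<le> M"
proof -
  have "card {v \<in> f ` X. k \<le> fibre_card f X v \<and> fibre_card f X v < 2 * k} \<le> card {v \<in> f ` X. k \<le> fibre_card f X v}"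
    using fin by (intro card_mono) auto
  then have "real (card {v \<in> f ` X. k \<le> fibre_card f X v \<and> fibre_card f X v < 2 * k}) * real k ^ 3
      \<le> real (card {v \<in> f ` X. k \<le> fibre_card f X v}) * real k ^ 3"
    by (intro mult_right_mono) auto
  then show ?thesis using rich[OF assms] by linarith
qed

text \<open>At exponent 3 the bound \<open>rich\<close> has no preferred scale: the heaviest dyadic
  level contributes at most 8 M whatever \<open>k\<close> is, the 8 coming from values up to 2
  k.\<close>

lemma third_moment_le: "(\<Sum>v\<in>f ` X. real (fibre_card f X v) ^ 3) \<le> 8 * real m * M"
proof -
  obtain k where k: "1 \<le> k" and le: "(\<Sum>v\<in>f ` X. real (fibre_card f X v) ^ 3) \<le>
    real m * (\<Sum>v | v \<in> f ` X \<and> k \<le> fibre_card f X v \<and> fibre_card f X v < 2 * k. real (fibre_card f X v) ^ 3)"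
    by (rule moment_dyadic)
  have "(\<Sum>v | v \<in> f ` X \<and> k \<le> fibre_card f X v \<and> fibre_card f X v < 2 * k. real (fibre_card f X v) ^ 3)
     \<le> real (card {v \<in> f ` X. k \<le> fibre_card f X v \<and> fibre_card f X v < 2 * k}) * (2 * real k) ^ 3"
    by (intro sum_bounded_above power_mono) auto
  also have "\<dots> = 8 * (real (card {v \<in> f ` X. k \<le> fibre_card f X v \<and> fibre_card f X v < 2 * k}) * real k ^ 3)"
    by (simp add: power_mult_distrib)
  also have "\<dots> \<le> 8 * M" using card_dyadic_le[OF k] by simp
  finally have "real m * (\<Sum>v | v \<in> f ` X \<and> k \<le> fibre_card f X v \<and> fibre_card f X v < 2 * k. real (fibre_card f X v) ^ 3)
     \<le> real m * (8 * M)" by (intro mult_left_mono) auto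
  then show ?thesis using le by (simp add: mult_ac)
qed

text \<open>On a dyadic level k the second moment is at most both 2 k |X| and 4 M / k, and the
  product of these bounds does not depend on k.\<close>

lemma second_moment_le:
  "(\<Sum>v\<in>f ` X. (real (fibre_card f X v))\<^sup>2)\<^sup>2 \<le> 8 * (real m)\<^sup>2 * M * real (card X)"
proof -
  obtain k where k: "1 \<le> k" and le: "(\<Sum>v\<in>f ` X. (real (fibre_card f X v))\<^sup>2) \<le>
    real m * (\<Sum>v | v \<in> f ` X \<and> k \<le> fibre_card f X v \<and> fibre_card f X v < 2 * k. (real (fibre_card f X v))\<^sup>2)"
    by (rule moment_dyadic)
  define D where "D = {v \<in> f ` X. k \<le> fibre_card f X v \<and> fibre_card f X v < 2 * k}"
  define s where "s = (\<Sum>v\<in>D. (real (fibre_card f X v))\<^sup>2)"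
  have "s \<le> real (card D) * (2 * real k)\<^sup>2"
    unfolding s_def D_def by (intro sum_bounded_above power_mono) auto
  then have "s * real k \<le> real (card D) * (2 * real k)\<^sup>2 * real k"
    by (rule mult_right_mono) simp
  also have "\<dots> = 4 * (real (card D) * real k ^ 3)" by (simp add: power2_eq_square power3_eq_cube)
  also have "\<dots> \<le> 4 * M" using card_dyadic_le[OF k] by (simp add: D_def)
  finally have a: "s * real k \<le> 4 * M" .
  have "s \<le> (\<Sum>v\<in>D. (2 * real k) * real (fibre_card f X v))"
    unfolding s_def power2_eq_square by (intro sum_mono mult_right_mono) (auto simp: D_def)
  also have "\<dots> \<le> (\<Sum>v\<in>f ` X. (2 * real k) * real (fibre_card f X v))"
    using fin by (intro sum_mono2) (auto simp: D_def)
  also have "\<dots> = 2 * real k * real (card X)" using sum_fibre_card[OF fin, of f] by (simp flip: sum_distrib_left)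
  finally have b: "s \<le> 2 * real k * real (card X)" .
  have s: "s \<ge> 0" unfolding s_def by (intro sum_nonneg) auto
  have M: "M \<ge> 0" using order_trans[OF _ rich[of 1], of 0] by simp
  have "s * real k * s \<le> 4 * M * (2 * real k * real (card X))"
    by (rule mult_mono[OF a b]) (use s M in auto)
  then have "real k * s\<^sup>2 \<le> real k * (8 * M * real (card X))" by (simp add: power2_eq_square algebra_simps)
  then have c: "s\<^sup>2 \<le> 8 * M * real (card X)" using k by simp
  have "(\<Sum>v\<in>f ` X. (real (fibre_card f X v))\<^sup>2)\<^sup>2 \<le> (real m * s)\<^sup>2"
    using le unfolding s_def D_def by (intro power_mono sum_nonneg) auto
  also have "\<dots> \<le> (real m)\<^sup>2 * (8 * M * real (card X))"
    unfolding power_mult_distrib using c by (intro mult_left_mono) auto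
  finally show ?thesis by (simp add: algebra_simps)
qed

end

section \<open>Popular ratios\<close>

text \<open>The fibre of \<open>f\<close> over (t, x) consists of the points of A \<times> A on the
  line of slope \<open>t\<close> and intercept \<open>x\<close>, so this is Szemeredi-Trotter for
  lines with at least \<open>k\<close> points.\<close>

lemma rich_lines_le:
  fixes A T :: "real set"
  assumes fin: "finite A" "finite T" and pos: "\<And>t. t \<in> T \<Longrightarrow> t > 0"
    and T: "card T \<le> (card A)\<^sup>2" and k: "1 \<le> k"
  defines "f \<equiv> \<lambda>(t, a, b). (t, b - t * a)"
  shows "real (card {v \<in> f ` (T \<times> A \<times> A). k \<le> fibre_card f (T \<times> A \<times> A) v}) * real k ^ 3 \<le> 64 * real (card A) ^ 4"
proof -
  let ?X = "T \<times> A \<times> A"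
  define L where "L = {v \<in> f ` ?X. k \<le> fibre_card f ?X v}"
  have finL: "finite L" using fin by (simp add: L_def)
  have LT: "t \<in> T" if "(t, x) \<in> L" for t x using that by (auto simp: L_def f_def)
  have Lpos: "t > 0" if "(t, x) \<in> L" for t x using that by (rule pos[OF LT])
  have "k \<le> card {a \<in> A. t * a + x \<in> A}" if "(t, x) \<in> L" for t x
  proof -
    have "k \<le> fibre_card f ?X (t, x)" using that by (simp add: L_def)
    also have "\<dots> \<le> card {a \<in> A. t * a + x \<in> A}" unfolding fibre_card_def
    proof (rule card_inj_on_le)
      show "inj_on (\<lambda>(t, a, b). a) {y \<in> ?X. f y = (t, x)}"
        by (auto simp: inj_on_def f_def)
    qed (use fin in \<open>auto simp: f_def\<close>)
    finally show ?thesis .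
  qed
  then have "(\<Sum>l\<in>L. real k) \<le> (\<Sum>(t, x)\<in>L. real (card {a \<in> A. t * a + x \<in> A}))"
    by (intro sum_mono) auto
  then have I: "real (card L) * real k \<le> (\<Sum>(t, x)\<in>L. real (card {a \<in> A. t * a + x \<in> A}))" by simp
  have cL: "real (card L) \<le> real (card A) ^ 4"
  proof -
    have "card L \<le> card ?X" unfolding L_def
      using fin by (intro order_trans[OF card_mono card_image_le]) auto
    also have "\<dots> \<le> card A ^ 4" using mult_right_mono[OF T, of "(card A)\<^sup>2"]
      by (simp add: card_cartesian_product power2_eq_square power4_eq_xxxx mult_ac)
    finally show ?thesis by (metis of_nat_le_iff of_nat_power)
  qed
  show ?thesis
  \<comment> \<open>For k \<le> 4 the linear alternative of Szemeredi-Trotter cannot be excluded,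
    but the trivial bound \<open>cL\<close> suffices there. For k > 4 the incidences number at least
    k |L| > 4 |L|, which leaves the cubic alternative.\<close>
  proof (cases "k \<le> 4 \<or> L = {}")
    case True
    then have "real (card L) * real k ^ 3 \<le> real (card L) * 4 ^ 3"
    proof
      assume "k \<le> 4"
      then have "real k ^ 3 \<le> 4 ^ 3" by (intro power_mono) auto
      then show ?thesis by (intro mult_left_mono) auto
    qed simp
    also have "\<dots> \<le> real (card A) ^ 4 * 4 ^ 3" using cL by (intro mult_right_mono) auto
    finally show ?thesis unfolding L_def by simp
  next
    case False
    then have L: "real (card L) > 0" using finL by (simp add: card_gt_0_iff)
    have "4 * real (card L) < real k * real (card L)" using False L by simp
    moreover have ST: "(\<Sum>(t, x)\<in>L. real (card {a \<in> A. t * a + x \<in> A})) \<le> 4 * real (card L) \<or>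
        (\<Sum>(t, x)\<in>L. real (card {a \<in> A. t * a + x \<in> A})) ^ 3
        \<le> 64 * (real (card A) * real (card A))\<^sup>2 * (real (card L))\<^sup>2"
      by (rule szemeredi_trotter_grid[OF fin(1) fin(1) finL]) (rule Lpos)
    ultimately have "\<not> (\<Sum>(t, x)\<in>L. real (card {a \<in> A. t * a + x \<in> A})) \<le> 4 * real (card L)"
      using I by (simp add: mult.commute)
    then have "(\<Sum>(t, x)\<in>L. real (card {a \<in> A. t * a + x \<in> A})) ^ 3
        \<le> 64 * (real (card A) * real (card A))\<^sup>2 * (real (card L))\<^sup>2"
      using ST by blast
    moreover have "(real (card L) * real k) ^ 3 \<le> (\<Sum>(t, x)\<in>L. real (card {a \<in> A. t * a + x \<in> A})) ^ 3"
      using I by (intro power_mono) auto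
    ultimately have "(real (card L) * real k) ^ 3 \<le> 64 * (real (card A) * real (card A))\<^sup>2 * (real (card L))\<^sup>2"
      by linarith
    then have "(real (card L))\<^sup>2 * (real (card L) * real k ^ 3) \<le> (real (card L))\<^sup>2 * (64 * real (card A) ^ 4)"
      by (simp add: power2_eq_square power3_eq_cube power4_eq_xxxx mult_ac)
    then show ?thesis using L unfolding L_def by simp
  qed
qed

text \<open>Used with F (b, b') = b' - t b: the equation t (b + c) = b' + c' has the form F = - F, and
  this compares it with the additive energy of A and t A.\<close>

lemma sum_fibre_card_uminus_le:
  fixes F :: "'a \<Rightarrow> real"
  assumes fin: "finite W"
  shows "(\<Sum>p\<in>W. real (fibre_card F W (- F p))) \<le> (\<Sum>p\<in>W. real (fibre_card F W (F p)))"
proof -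
  define a where "a v = real (fibre_card F W v)" for v
  have zero: "a v = 0" if "v \<notin> F ` W" for v
  proof -
    have "{x \<in> W. F x = v} = {}" using that by auto
    then show ?thesis by (simp only: a_def fibre_card_def card.empty of_nat_0)
  qed
  have "(\<Sum>v\<in>F ` W. (a (- v))\<^sup>2) = (\<Sum>v\<in>uminus ` F ` W. (a v)\<^sup>2)"
    by (simp add: sum.reindex)
  also have "\<dots> = (\<Sum>v\<in>uminus ` F ` W \<inter> F ` W. (a v)\<^sup>2)"
    using fin zero by (intro sum.mono_neutral_right) auto
  also have "\<dots> \<le> (\<Sum>v\<in>F ` W. (a v)\<^sup>2)" using fin by (intro sum_mono2) auto
  finally have *: "(\<Sum>v\<in>F ` W. (a (- v))\<^sup>2) \<le> (\<Sum>v\<in>F ` W. (a v)\<^sup>2)" .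
  have "2 * (\<Sum>p\<in>W. real (fibre_card F W (- F p))) = (\<Sum>v\<in>F ` W. 2 * a v * a (- v))"
    using sum_comp_eq_sum_fibre_card[OF fin, of "\<lambda>v. real (fibre_card F W (- v))" F]
    by (simp add: a_def sum_distrib_left mult.assoc)
  also have "\<dots> \<le> (\<Sum>v\<in>F ` W. (a v)\<^sup>2 + (a (- v))\<^sup>2)"
    by (intro sum_mono) (metis sum_squares_bound)
  also have "\<dots> \<le> 2 * (\<Sum>v\<in>F ` W. (a v)\<^sup>2)" using * by (simp add: sum.distrib)
  also have "(\<Sum>v\<in>F ` W. (a v)\<^sup>2) = (\<Sum>p\<in>W. real (fibre_card F W (F p)))"
    unfolding a_def by (rule sum_fibre_card_square[OF fin])
  finally show ?thesis by simp
qed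

text \<open>Weighted by the number of representations t = a / a', these counts add up to the number
  of solutions of a (b + c) = a' (b' + c').\<close>

definition dilate_count :: "real set \<Rightarrow> real \<Rightarrow> nat" where
  "dilate_count A t = card {(b, c, b', c'). b \<in> A \<and> c \<in> A \<and> b' \<in> A \<and> c' \<in> A \<and> t * (b + c) = b' + c'}"

text \<open>After passing from F = - F to F = F, the sum over \<open>T\<close> is at most the second
  moment of the line parameters (t, b - t a), which \<open>rich_lines_le\<close> controls with M =
  64 |A|^4; hence 512 = 8 * 64.\<close>

lemma sum_dilate_count_le:
  fixes A T :: "real set"
  assumes fin: "finite A" "finite T" and pos: "\<And>t. t \<in> T \<Longrightarrow> t > 0"
    and T: "card T \<le> (card A)\<^sup>2" and m: "card A ^ 4 < 2 ^ m"
  shows "(\<Sum>t\<in>T. real (dilate_count A t))\<^sup>2 \<le> 512 * (real m)\<^sup>2 * real (card A) ^ 6 * real (card T)"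
proof -
  let ?X = "T \<times> A \<times> A" and ?W = "A \<times> A"
  define F where "F t = (\<lambda>(a, b). b - t * a)" for t :: real
  define f where "f = (\<lambda>(t::real, a, b). (t, b - t * a))"
  have dc: "real (dilate_count A t) = (\<Sum>p\<in>?W. real (fibre_card (F t) ?W (- F t p)))" for t
  proof -
    have "bij_betw (\<lambda>(b, c, b', c'). ((b, b'), (c, c')))
      {(b, c, b', c'). b \<in> A \<and> c \<in> A \<and> b' \<in> A \<and> c' \<in> A \<and> t * (b + c) = b' + c'}
      (Sigma ?W (\<lambda>p. {q \<in> ?W. F t q = - F t p}))"
      by (rule bij_betwI[where g = "\<lambda>((b, b'), (c, c')). (b, c, b', c')"])
        (auto simp: F_def algebra_simps)
    then have "dilate_count A t = card (Sigma ?W (\<lambda>p. {q \<in> ?W. F t q = - F t p}))"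
      unfolding dilate_count_def by (rule bij_betw_same_card)
    also have "\<dots> = (\<Sum>p\<in>?W. fibre_card (F t) ?W (- F t p))"
      unfolding fibre_card_def using fin by (intro card_SigmaI) auto
    finally show ?thesis by simp
  qed
  \<comment> \<open>Keeping \<open>t\<close> as the first coordinate of \<open>f\<close> merges the
    energies for all \<open>t\<close> into a single second moment.\<close>
  have fibre_card: "fibre_card f ?X (t, x) = fibre_card (F t) ?W x" if "t \<in> T" for t x
    unfolding fibre_card_def
    by (rule bij_betw_same_card[of snd], rule bij_betwI[where g = "Pair t"])
      (use that in \<open>auto simp: f_def F_def\<close>)
  have "(\<Sum>t\<in>T. real (dilate_count A t)) \<le> (\<Sum>t\<in>T. \<Sum>p\<in>?W. real (fibre_card (F t) ?W (F t p)))"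
    unfolding dc using fin by (intro sum_mono sum_fibre_card_uminus_le) auto
  also have "\<dots> = (\<Sum>t\<in>T. \<Sum>p\<in>?W. real (fibre_card f ?X (f (t, p))))"
    by (intro sum.cong refl) (auto simp: fibre_card[symmetric] f_def[THEN fun_cong] F_def[THEN fun_cong])
  also have "\<dots> = (\<Sum>x\<in>?X. real (fibre_card f ?X (f x)))"
    by (simp add: sum.cartesian_product)
  also have "\<dots> = (\<Sum>v\<in>f ` ?X. (real (fibre_card f ?X v))\<^sup>2)"
    using fin by (subst sum_fibre_card_square) auto
  finally have le: "(\<Sum>t\<in>T. real (dilate_count A t)) \<le> (\<Sum>v\<in>f ` ?X. (real (fibre_card f ?X v))\<^sup>2)" .
  have "card ?X \<le> card A ^ 4"
    using mult_right_mono[OF T, of "(card A)\<^sup>2"]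
    by (simp add: card_cartesian_product power2_eq_square power4_eq_xxxx mult_ac)
  then have "card ?X < 2 ^ m" using m by linarith
  then have "(\<Sum>v\<in>f ` ?X. (real (fibre_card f ?X v))\<^sup>2)\<^sup>2 \<le> 8 * (real m)\<^sup>2 * (64 * real (card A) ^ 4) * real (card ?X)"
    using fin rich_lines_le[OF fin pos T] unfolding f_def by (intro second_moment_le) auto
  also have "real (card ?X) = real (card T) * (real (card A))\<^sup>2"
    by (simp add: card_cartesian_product power2_eq_square)
  also have "8 * (real m)\<^sup>2 * (64 * real (card A) ^ 4) * (real (card T) * (real (card A))\<^sup>2)
      = 512 * (real m)\<^sup>2 * real (card A) ^ 6 * real (card T)"
    by (simp add: mult_ac flip: power_add)
  finally have "(\<Sum>v\<in>f ` ?X. (real (fibre_card f ?X v))\<^sup>2)\<^sup>2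
      \<le> 512 * (real m)\<^sup>2 * real (card A) ^ 6 * real (card T)" .
  moreover have "(\<Sum>t\<in>T. real (dilate_count A t))\<^sup>2 \<le> (\<Sum>v\<in>f ` ?X. (real (fibre_card f ?X v))\<^sup>2)\<^sup>2"
    using le by (intro power_mono sum_nonneg) auto
  ultimately show ?thesis by linarith
qed

text \<open>By Cauchy-Schwarz, |A|^6 is at most |A(A+A)| times the number of solutions of a (b + c)
  = a' (b' + c'). Sorting these by t = a / a' and pigeonholing the multiplicity of \<open>t\<close>
  leaves one level, to which \<open>sum_dilate_count_le\<close> applies.\<close>

lemma popular_ratios:
  fixes A :: "real set"
  assumes fin: "finite A" and pos: "\<And>a. a \<in> A \<Longrightarrow> a > 0" and ne: "A \<noteq> {}" and m: "card A ^ 4 < 2 ^ m"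
  defines "r \<equiv> fibre_card (\<lambda>(a, a'). a / a') (A \<times> A)"
  obtains \<rho> :: nat and T where "1 \<le> \<rho>" "T \<subseteq> (\<lambda>(a, a'). a / a') ` (A \<times> A)" "\<forall>t\<in>T. \<rho> \<le> r t"
    "real (card A) ^ 6 \<le> 2048 * (real (card (prod_sum_set A)))\<^sup>2 * real m ^ 4 * (real \<rho>)\<^sup>2 * real (card T)"
proof -
  let ?\<phi> = "\<lambda>(a, a'). a / a' :: real" and ?W = "A \<times> A" and ?Y = "A \<times> A \<times> A"
  define h :: "real \<times> real \<times> real \<Rightarrow> real" where "h = (\<lambda>(a, b, c). a * (b + c))"
  define N s where "N = real (card A)" and "s = real (card (prod_sum_set A))"
  have N: "N > 0" using ne fin by (simp add: N_def card_gt_0_iff)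
  have m0: "m > 0" using m ne fin by (cases m) (auto simp: card_gt_0_iff)
  have hY: "h ` ?Y = prod_sum_set A"
    by (force simp: h_def prod_sum_set_def)
  have Q: "N ^ 6 \<le> s * (\<Sum>v\<in>h ` ?Y. (real (fibre_card h ?Y v))\<^sup>2)"
    using card_square_le_energy[of ?Y h] fin
    by (simp add: hY N_def s_def card_cartesian_product power2_eq_square eval_nat_numeral mult_ac)
  have "(\<Sum>v\<in>h ` ?Y. (real (fibre_card h ?Y v))\<^sup>2) = real (card {(p, q). p \<in> ?Y \<and> q \<in> ?Y \<and> h p = h q})"
    using fin by (intro sum_fibre_card_square_eq_card) auto
  \<comment> \<open>Dividing by a' > 0 turns the equation into t (b + c) = b' + c' with t = a /
    a'.\<close>
  also have "card {(p, q). p \<in> ?Y \<and> q \<in> ?Y \<and> h p = h q}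
     = card (Sigma ?W (\<lambda>x. {(b, c, b', c'). b \<in> A \<and> c \<in> A \<and> b' \<in> A \<and> c' \<in> A \<and> ?\<phi> x * (b + c) = b' + c'}))"
  proof (rule bij_betw_same_card, rule bij_betwI)
    let ?f = "\<lambda>((a, b, c), (a', b', c')). ((a, a'), (b, c, b', c'))"
    let ?g = "\<lambda>((a, a'), (b, c, b', c')). ((a, b, c), (a', b', c'))"
    show "?f \<in> {(p, q). p \<in> ?Y \<and> q \<in> ?Y \<and> h p = h q} \<rightarrow>
      Sigma ?W (\<lambda>x. {(b, c, b', c'). b \<in> A \<and> c \<in> A \<and> b' \<in> A \<and> c' \<in> A \<and> ?\<phi> x * (b + c) = b' + c'})"
      using pos by (force simp: h_def field_simps)
    show "?g \<in> Sigma ?W (\<lambda>x. {(b, c, b', c'). b \<in> A \<and> c \<in> A \<and> b' \<in> A \<and> c' \<in> A \<and> ?\<phi> x * (b + c) = b' + c'})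
      \<rightarrow> {(p, q). p \<in> ?Y \<and> q \<in> ?Y \<and> h p = h q}"
      using pos by (force simp: h_def field_simps)
  qed auto
  also have "\<dots> = (\<Sum>x\<in>?W. dilate_count A (?\<phi> x))"
  proof -
    have "finite {(b, c, b', c'). b \<in> A \<and> c \<in> A \<and> b' \<in> A \<and> c' \<in> A \<and> t * (b + c) = b' + c'}" for t
      by (rule finite_subset[of _ "A \<times> A \<times> A \<times> A"]) (use fin in auto)
    then show ?thesis unfolding dilate_count_def using fin by (intro card_SigmaI) auto
  qed
  also have "real \<dots> = (\<Sum>x\<in>?W. real (dilate_count A (?\<phi> x)))" by simp
  also have "\<dots> = (\<Sum>t\<in>?\<phi> ` ?W. real (r t) * real (dilate_count A t))"
    unfolding r_def using fin by (intro sum_comp_eq_sum_fibre_card) auto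
  finally have Q': "(\<Sum>v\<in>h ` ?Y. (real (fibre_card h ?Y v))\<^sup>2) = (\<Sum>t\<in>?\<phi> ` ?W. real (r t) * real (dilate_count A t))" .
  have r1: "1 \<le> r t" if "t \<in> ?\<phi> ` ?W" for t
    unfolding r_def using that fin by (intro fibre_card_pos) auto
  have r2: "r t < 2 ^ m" for t
  proof -
    have "r t \<le> card ?W" unfolding r_def using fin by (intro fibre_card_le_card) auto
    also have "\<dots> \<le> card A ^ 4"
      using ne fin by (simp add: card_cartesian_product power4_eq_xxxx mult_le_mono Suc_le_eq card_gt_0_iff)
    finally show ?thesis using m by simp
  qed
  have "\<exists>j. (\<Sum>t\<in>?\<phi> ` ?W. real (r t) * real (dilate_count A t)) \<le>
    real m * (\<Sum>t | t \<in> ?\<phi> ` ?W \<and> 2 ^ j \<le> r t \<and> r t < 2 * 2 ^ j. real (r t) * real (dilate_count A t))"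
    by (rule dyadic_pigeonhole[OF _ r1 r2 m0]) (use fin in auto)
  then obtain j where j: "(\<Sum>t\<in>?\<phi> ` ?W. real (r t) * real (dilate_count A t)) \<le>
    real m * (\<Sum>t | t \<in> ?\<phi> ` ?W \<and> 2 ^ j \<le> r t \<and> r t < 2 * 2 ^ j. real (r t) * real (dilate_count A t))" ..
  define \<rho> :: nat where "\<rho> = 2 ^ j"
  define T where "T = {t \<in> ?\<phi> ` ?W. \<rho> \<le> r t \<and> r t < 2 * \<rho>}"
  define S where "S = (\<Sum>t\<in>T. real (dilate_count A t))"
  have finT: "finite T" using fin by (simp add: T_def)
  have Tsub: "T \<subseteq> ?\<phi> ` ?W" by (auto simp: T_def)
  have "card T \<le> card (?\<phi> ` ?W)" using Tsub fin by (intro card_mono) auto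
  also have "\<dots> \<le> card ?W" using fin by (intro card_image_le) auto
  finally have cT: "card T \<le> (card A)\<^sup>2" by (simp add: card_cartesian_product power2_eq_square)
  have S2: "S\<^sup>2 \<le> 512 * (real m)\<^sup>2 * N ^ 6 * real (card T)"
    unfolding S_def N_def using Tsub pos by (intro sum_dilate_count_le fin finT cT m) fastforce
  have "(\<Sum>t\<in>T. real (r t) * real (dilate_count A t)) \<le> (\<Sum>t\<in>T. (2 * real \<rho>) * real (dilate_count A t))"
    by (intro sum_mono mult_right_mono) (auto simp: T_def)
  also have "\<dots> = 2 * real \<rho> * S" by (simp add: S_def sum_distrib_left)
  finally have "real m * (\<Sum>t\<in>T. real (r t) * real (dilate_count A t)) \<le> real m * (2 * real \<rho> * S)"
    by (intro mult_left_mono) auto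
  then have "(\<Sum>v\<in>h ` ?Y. (real (fibre_card h ?Y v))\<^sup>2) \<le> real m * (2 * real \<rho> * S)"
    using j unfolding Q' T_def \<rho>_def by linarith
  then have "s * (\<Sum>v\<in>h ` ?Y. (real (fibre_card h ?Y v))\<^sup>2) \<le> s * (real m * (2 * real \<rho> * S))"
    by (intro mult_left_mono) (auto simp: s_def)
  then have "N ^ 6 \<le> s * (real m * (2 * real \<rho> * S))" using Q by linarith
  \<comment> \<open>\<open>S2\<close> bounds the square of \<open>S\<close>; its factor N^6 cancels
    half of the left side.\<close>
  then have "(N ^ 6)\<^sup>2 \<le> (s * (real m * (2 * real \<rho> * S)))\<^sup>2"
    using N by (intro power_mono) auto
  also have "\<dots> = (4 * s\<^sup>2 * (real m)\<^sup>2 * (real \<rho>)\<^sup>2) * S\<^sup>2"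
    by (simp add: power_mult_distrib mult_ac)
  also have "\<dots> \<le> (4 * s\<^sup>2 * (real m)\<^sup>2 * (real \<rho>)\<^sup>2) * (512 * (real m)\<^sup>2 * N ^ 6 * real (card T))"
    using S2 by (intro mult_left_mono) auto
  also have "\<dots> = N ^ 6 * (2048 * s\<^sup>2 * real m ^ 4 * (real \<rho>)\<^sup>2 * real (card T))"
    by (simp add: power2_eq_square power4_eq_xxxx mult_ac)
  finally have "N ^ 6 * N ^ 6 \<le> N ^ 6 * (2048 * s\<^sup>2 * real m ^ 4 * (real \<rho>)\<^sup>2 * real (card T))"
    by (simp add: power2_eq_square)
  then have "N ^ 6 \<le> 2048 * s\<^sup>2 * real m ^ 4 * (real \<rho>)\<^sup>2 * real (card T)"
    by (rule mult_left_le_imp_le) (use N in simp)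
  then show ?thesis
    using that[of \<rho> T] Tsub unfolding N_def s_def by (auto simp: \<rho>_def T_def)
qed

section \<open>Sumsets of sets with few popular differences\<close>

text \<open>If x = b - c is popular, each \<open>a\<close> with b / a in \<open>T\<close> puts the
  point (a, x) on the line of slope b / a and intercept - c. With d popular differences this gives
  at least d k q incidences of A \<times> D with |T| |C| lines, and Szemeredi-Trotter bounds
  d.\<close>

lemma popular_differences_le:
  fixes A B C T :: "real set"
  assumes fin: "finite A" "finite T" "finite C" and pos: "\<And>a. a \<in> A \<Longrightarrow> a > 0" "\<And>t. t \<in> T \<Longrightarrow> t > 0"
    and B: "B \<subseteq> A" "\<And>b. b \<in> B \<Longrightarrow> q \<le> card {a \<in> A. b / a \<in> T}" and k: "1 \<le> k"
  defines "f \<equiv> \<lambda>(b, c). b - c"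
  shows "real (card {x \<in> f ` (B \<times> C). k \<le> fibre_card f (B \<times> C) x}) * real k ^ 3 * real q ^ 3
    \<le> 64 * (real (card A))\<^sup>2 * (real (card T))\<^sup>2 * (real (card C))\<^sup>2"
proof -
  define D where "D = {x \<in> f ` (B \<times> C). k \<le> fibre_card f (B \<times> C) x}"
  have finB: "finite B" using B(1) fin(1) by (rule finite_subset)
  have finD: "finite D" using finB fin by (simp add: D_def)
  define L where "L = (\<lambda>(t, c). (t, - c)) ` (T \<times> C)"
  have cL: "card L = card T * card C"
    unfolding L_def by (subst card_image) (auto simp: inj_on_def card_cartesian_product)
  have finL: "finite L" using fin by (simp add: L_def)
  define n where "n l = {x \<in> A. fst l * x + snd l \<in> D}" for l
  have split: "(\<Sum>(t, b)\<in>L. real (card {x \<in> A. t * x + b \<in> D})) = (\<Sum>l\<in>L. real (card (n l)))"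
    by (simp add: n_def split_def)
  define d where "d = real (card D)"
  define G where "G = {(b, c). b \<in> B \<and> c \<in> C \<and> b - c \<in> D}"
  have finG: "finite G" by (rule finite_subset[of _ "B \<times> C"]) (use finB fin in \<open>auto simp: G_def\<close>)
  have G: "d * real k \<le> real (card G)"
  proof -
    have eq: "(\<lambda>(x, y). y) ` Sigma D (\<lambda>x. {y \<in> B \<times> C. f y = x}) = G"
      by (force simp: G_def f_def image_iff)
    have "card G = card (Sigma D (\<lambda>x. {y \<in> B \<times> C. f y = x}))"
      unfolding eq[symmetric] by (rule card_image) (auto simp: inj_on_def)
    also have "\<dots> = (\<Sum>x\<in>D. fibre_card f (B \<times> C) x)" unfolding fibre_card_def using finD finB fin by (intro card_SigmaI) auto
    finally have "card G = (\<Sum>x\<in>D. fibre_card f (B \<times> C) x)" .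
    moreover have "(\<Sum>x\<in>D. k) \<le> (\<Sum>x\<in>D. fibre_card f (B \<times> C) x)" by (intro sum_mono) (auto simp: D_def)
    ultimately have "card D * k \<le> card G" by simp
    then show ?thesis unfolding d_def by (metis of_nat_le_iff of_nat_mult)
  qed
  have I: "d * real k * real q \<le> (\<Sum>l\<in>L. real (card (n l)))"
  proof -
    have "(\<Sum>y\<in>G. q) \<le> (\<Sum>y\<in>G. card {a \<in> A. fst y / a \<in> T})"
      using B(2) by (intro sum_mono) (auto simp: G_def)
    also have "\<dots> = card (Sigma G (\<lambda>y. {a \<in> A. fst y / a \<in> T}))"
      using finG fin by (intro card_SigmaI[symmetric]) auto
    also have "\<dots> \<le> card (Sigma L n)"
    proof (rule card_inj_on_le)
      \<comment> \<open>Injective, since the abscissa \<open>a\<close> and the slope b / a recover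
        \<open>b\<close>.\<close>
      let ?g = "\<lambda>((b, c), a). ((b / a, - c), a)"
      show "inj_on ?g (Sigma G (\<lambda>y. {a \<in> A. fst y / a \<in> T}))"
        using pos(1) by (force simp: inj_on_def field_simps)
      show "?g ` Sigma G (\<lambda>y. {a \<in> A. fst y / a \<in> T}) \<subseteq> Sigma L n"
      proof
        fix z assume "z \<in> ?g ` Sigma G (\<lambda>y. {a \<in> A. fst y / a \<in> T})"
        then obtain y where y: "y \<in> Sigma G (\<lambda>y. {a \<in> A. fst y / a \<in> T})" "z = ?g y" by blast
        obtain b c a where "y = ((b, c), a)" by (metis surj_pair)
        with y have z: "z = ((b / a, - c), a)" "(b, c) \<in> G" "a \<in> A" "b / a \<in> T" by auto
        then have "b / a * a = b" using pos(1) by force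
        then show "z \<in> Sigma L n" using z by (auto simp: L_def n_def G_def)
      qed
      show "finite (Sigma L n)" using finL fin by (intro finite_SigmaI) (auto simp: n_def)
    qed
    also have "\<dots> = (\<Sum>l\<in>L. card (n l))" using finL fin by (intro card_SigmaI) (auto simp: n_def)
    finally have "real (card G * q) \<le> real (\<Sum>l\<in>L. card (n l))" by (simp only: sum_constant of_nat_le_iff of_nat_id)
    moreover have "d * real k * real q \<le> real (card G) * real q"
      using G by (intro mult_right_mono) auto
    ultimately show ?thesis by simp
  qed
  have "d * real k ^ 3 * real q ^ 3 \<le> 64 * (real (card A))\<^sup>2 * (real (card T))\<^sup>2 * (real (card C))\<^sup>2"
  proof (cases "D = {} \<or> q = 0")
    case True
    then show ?thesis by (auto simp: d_def)
  next
    case False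
    then obtain b c where bc: "b \<in> B" "c \<in> C" "k \<le> fibre_card f (B \<times> C) (b - c)"
      by (auto simp: D_def f_def)
    have dpos: "d > 0" using False finD by (simp add: d_def card_gt_0_iff)
    have qpos: "q > 0" using False by simp
    have kC: "k \<le> card C"
    proof -
      have "fibre_card f (B \<times> C) (b - c) \<le> card C" unfolding fibre_card_def
        by (rule card_inj_on_le[of snd]) (use fin in \<open>auto simp: inj_on_def f_def\<close>)
      then show ?thesis using bc by simp
    qed
    have kA: "k \<le> card A"
    proof -
      have "fibre_card f (B \<times> C) (b - c) \<le> card A" unfolding fibre_card_def
        by (rule card_inj_on_le[of fst]) (use fin B(1) in \<open>auto simp: inj_on_def f_def\<close>)
      then show ?thesis using bc by simp
    qed
    have qA: "q \<le> card A" using B(2)[OF bc(1)] card_mono[OF fin(1), of "{a \<in> A. b / a \<in> T}"] by fastforce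
    have qT: "q \<le> card T"
    proof -
      have "b > 0" using bc B(1) pos(1) by auto
      then have "card {a \<in> A. b / a \<in> T} \<le> card T"
        using pos(1) by (intro card_inj_on_le[of "\<lambda>a. b / a"] fin) (auto simp: inj_on_def)
      then show ?thesis using B(2)[OF bc(1)] by simp
    qed
    consider "d * real k * real q \<le> 4 * real (card L)"
      | "(d * real k * real q) ^ 3 \<le> 64 * (real (card A) * d)\<^sup>2 * (real (card L))\<^sup>2"
    proof -
      have Lpos: "t > 0" if "(t, b) \<in> L" for t b using that pos(2) by (auto simp: L_def)
      have "(\<Sum>l\<in>L. real (card (n l))) \<le> 4 * real (card L) \<or>
          (\<Sum>l\<in>L. real (card (n l))) ^ 3 \<le> 64 * (real (card A) * d)\<^sup>2 * (real (card L))\<^sup>2"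
        unfolding split[symmetric] d_def
        by (rule szemeredi_trotter_grid[OF fin(1) finD finL]) (rule Lpos)
      moreover have "(d * real k * real q) ^ 3 \<le> (\<Sum>l\<in>L. real (card (n l))) ^ 3"
        using I dpos by (intro power_mono) auto
      ultimately show thesis using that I by linarith
    qed
    then show ?thesis
    proof cases
      case 1
      \<comment> \<open>In the linear alternative, multiplying by the trivial bounds on k^2 and q^2
        produces a bound of the same shape as the cubic one.\<close>
      have "real k * real k \<le> real (card A) * real (card C)" "real q * real q \<le> real (card A) * real (card T)"
        using kA kC qA qT by (simp_all add: mult_mono)
      then have "(real k * real k) * (real q * real q) \<le> (real (card A) * real (card C)) * (real (card A) * real (card T))"
        by (rule mult_mono) auto
      with 1 have "(d * real k * real q) * ((real k * real k) * (real q * real q))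
        \<le> 4 * real (card L) * ((real (card A) * real (card C)) * (real (card A) * real (card T)))"
        using dpos by - (rule mult_mono, auto)
      also have "\<dots> = 4 * ((real (card A))\<^sup>2 * (real (card T))\<^sup>2 * (real (card C))\<^sup>2)"
        by (simp add: cL power2_eq_square)
      also have "\<dots> \<le> 64 * ((real (card A))\<^sup>2 * (real (card T))\<^sup>2 * (real (card C))\<^sup>2)" by simp
      finally show ?thesis by (simp add: power3_eq_cube mult_ac)
    next
      case 2
      \<comment> \<open>\<open>D\<close> is also the second coordinate set of the grid, so two of
        the three factors d cancel.\<close>
      then have "d\<^sup>2 * (d * real k ^ 3 * real q ^ 3)
          \<le> d\<^sup>2 * (64 * (real (card A))\<^sup>2 * (real (card T))\<^sup>2 * (real (card C))\<^sup>2)"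
        by (simp add: cL power2_eq_square power3_eq_cube mult_ac)
      then show ?thesis using dpos by (simp only: mult_le_cancel_left_pos zero_less_power)
    qed
  qed
  then show ?thesis by (simp add: d_def D_def)
qed

section \<open>Energies of the sets B \<inter> (B + s) and the sumset bound\<close>

text \<open>A solution of b + u = c + w with u, w, u - s, w - s in \<open>B\<close> gives three
  equal differences b - c = w - u = (w - s) - (u - s). From these pairs \<open>s\<close> can be read
  off, so no triple is counted twice.\<close>

lemma sum_energy_translates_le:
  fixes B P :: "real set"
  assumes fin: "finite B" "finite P"
  defines "Bs s \<equiv> {b \<in> B. b - s \<in> B}" and "f \<equiv> \<lambda>(b, c). b - c"
  shows "(\<Sum>s\<in>P. \<Sum>v\<in>(\<lambda>(x, y). x + y) ` (B \<times> Bs s). (real (fibre_card (\<lambda>(x, y). x + y) (B \<times> Bs s) v))\<^sup>2)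
    \<le> (\<Sum>v\<in>f ` (B \<times> B). real (fibre_card f (B \<times> B) v) ^ 3)"
proof -
  let ?E = "\<lambda>s. {(p, q). p \<in> B \<times> Bs s \<and> q \<in> B \<times> Bs s \<and> (\<lambda>(x, y). x + y) p = (\<lambda>(x, y). x + y) q}"
  let ?F = "{(p, q, r). p \<in> B \<times> B \<and> q \<in> B \<times> B \<and> r \<in> B \<times> B \<and> f p = f q \<and> f p = f r}"
  have finBs: "finite (Bs s)" for s using fin by (simp add: Bs_def)
  have finE: "finite (?E s)" for s
    by (rule finite_subset[of _ "(B \<times> Bs s) \<times> (B \<times> Bs s)"]) (use fin finBs in auto)
  have finF: "finite ?F"
    by (rule finite_subset[of _ "(B \<times> B) \<times> (B \<times> B) \<times> (B \<times> B)"]) (use fin in auto)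
  have "(\<Sum>s\<in>P. \<Sum>v\<in>(\<lambda>(x, y). x + y) ` (B \<times> Bs s). (real (fibre_card (\<lambda>(x, y). x + y) (B \<times> Bs s) v))\<^sup>2)
     = (\<Sum>s\<in>P. real (card (?E s)))"
    using fin finBs by (intro sum.cong sum_fibre_card_square_eq_card refl) auto
  also have "\<dots> = real (card (Sigma P ?E))" using fin finE by (subst card_SigmaI) auto
  also have "card (Sigma P ?E) \<le> card ?F"
  proof (rule card_inj_on_le)
    let ?g = "\<lambda>(s, ((b, u), (c, w))). ((b, c), (w, u), (w - s, u - s))"
    show "inj_on ?g (Sigma P ?E)" by (auto simp: inj_on_def)
    show "?g ` Sigma P ?E \<subseteq> ?F" by (auto simp: f_def Bs_def)
  qed (rule finF)
  also have "real (card ?F) = (\<Sum>v\<in>f ` (B \<times> B). real (fibre_card f (B \<times> B) v) ^ 3)"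
    using fin by (intro sum_fibre_card_cube[symmetric]) auto
  finally show ?thesis by simp
qed

text \<open>If s = b - b', then b - y = b' - (y - s): every counted configuration is a coincidence
  of two differences between \<open>B\<close> and \<open>S\<close>, and b - b' recovers
  \<open>s\<close>.\<close>

lemma sum_fibre_card_mult_translates_le:
  fixes B P S :: "real set"
  assumes fin: "finite B" "finite P" "finite S"
  defines "f \<equiv> \<lambda>(b, c). b - c"
  shows "(\<Sum>s\<in>P. real (fibre_card f (B \<times> B) s) * real (card {y \<in> S. y - s \<in> S}))
    \<le> (\<Sum>v\<in>f ` (B \<times> S). (real (fibre_card f (B \<times> S) v))\<^sup>2)"
proof -
  let ?E = "\<lambda>s. {x \<in> B \<times> B. f x = s} \<times> {y \<in> S. y - s \<in> S}"
  let ?F = "{(p, q). p \<in> B \<times> S \<and> q \<in> B \<times> S \<and> f p = f q}"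
  have "(\<Sum>s\<in>P. real (fibre_card f (B \<times> B) s) * real (card {y \<in> S. y - s \<in> S})) = real (card (Sigma P ?E))"
    using fin by (subst card_SigmaI) (auto simp: fibre_card_def card_cartesian_product)
  also have "card (Sigma P ?E) \<le> card ?F"
  proof (rule card_inj_on_le)
    let ?g = "\<lambda>(s, ((b, b'), y)). ((b, y), (b', y - s))"
    show "inj_on ?g (Sigma P ?E)" by (auto simp: inj_on_def)
    show "?g ` Sigma P ?E \<subseteq> ?F" by (auto simp: f_def)
    show "finite ?F"
      by (rule finite_subset[of _ "(B \<times> S) \<times> (B \<times> S)"]) (use fin in auto)
  qed
  also have "real (card ?F) = (\<Sum>v\<in>f ` (B \<times> S). (real (fibre_card f (B \<times> S) v))\<^sup>2)"
    using fin by (intro sum_fibre_card_square_eq_card[symmetric]) auto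
  finally show ?thesis by simp
qed

text \<open>Let B' be the set of b in B with b - s in B, so that B + B' lies in the intersection
  of S and S + s (Katz--Koester). Cauchy--Schwarz bounds |B|^2 |B'|^2 by the energy of B and B' times
  the size of this intersection. Summed over the popular differences s, the first factor is at
  most the third moment of the differences of B, the second is controlled by the energy of B
  and S.\<close>

lemma card_sumset_ge:
  fixes B :: "real set" and M :: real
  defines "f \<equiv> \<lambda>(b, c). b - c" and "S \<equiv> (\<lambda>(b, c). b + c) ` (B \<times> B)"
  assumes fin: "finite B" and ne: "B \<noteq> {}" and m: "card B * card S < 2 ^ m"
    and rich: "\<And>C k. finite C \<Longrightarrow> 1 \<le> k \<Longrightarrow>
      real (card {x \<in> f ` (B \<times> C). k \<le> fibre_card f (B \<times> C) x}) * real k ^ 3 \<le> M * (real (card C))\<^sup>2"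
  shows "real (card B) ^ 19 \<le> 2 ^ 21 * real m ^ 10 * real (card S) ^ 9 * M ^ 5"
proof -
  define \<beta> \<sigma> \<mu> where "\<beta> = real (card B)" and "\<sigma> = real (card S)" and "\<mu> = real m"
  define r where "r = fibre_card f (B \<times> B)"
  define E3 where "E3 = (\<Sum>v\<in>f ` (B \<times> B). real (fibre_card f (B \<times> B) v) ^ 3)"
  define W where "W = (\<Sum>v\<in>f ` (B \<times> S). (real (fibre_card f (B \<times> S) v))\<^sup>2)"
  have \<beta>: "\<beta> > 0" using fin ne by (simp add: \<beta>_def card_gt_0_iff)
  have finS: "finite S" using fin by (simp add: S_def)
  have BS: "card B \<le> card S"
  proof -
    obtain b where "b \<in> B" using ne by auto
    then show ?thesis using fin finS
      by (intro card_inj_on_le[of "\<lambda>c. b + c"]) (auto simp: S_def inj_on_def)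
  qed
  have mB: "card (B \<times> B) < 2 ^ m"
    using le_less_trans[OF mult_le_mono2[OF BS] m] by (simp add: card_cartesian_product)
  have mS: "card (B \<times> S) < 2 ^ m" using m by (simp add: card_cartesian_product)
  have m0: "m > 0" using mB fin ne by (cases m) (auto simp: card_gt_0_iff card_cartesian_product)
  have M: "M \<ge> 0"
  proof -
    have "0 \<le> real (card {x \<in> f ` (B \<times> B). 1 \<le> fibre_card f (B \<times> B) x}) * real 1 ^ 3" by simp
    also have "\<dots> \<le> M * \<beta>\<^sup>2" unfolding \<beta>_def by (rule rich[OF fin]) simp
    finally show ?thesis using \<beta> by (simp add: zero_le_mult_iff)
  qed
  have E3: "E3 \<le> 8 * \<mu> * (M * \<beta>\<^sup>2)"
    unfolding E3_def \<mu>_def \<beta>_def using fin mB rich[OF fin] by (intro third_moment_le) auto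
  have W: "W\<^sup>2 \<le> 8 * \<mu>\<^sup>2 * M * \<beta> * \<sigma> ^ 3"
  proof -
    have "W\<^sup>2 \<le> 8 * (real m)\<^sup>2 * (M * (real (card S))\<^sup>2) * real (card (B \<times> S))"
      unfolding W_def using fin finS mS rich[OF finS] by (intro second_moment_le) auto
    then show ?thesis
      by (simp add: \<mu>_def \<beta>_def \<sigma>_def card_cartesian_product power2_eq_square power3_eq_cube mult_ac)
  qed
  have W0: "W \<ge> 0" unfolding W_def by (intro sum_nonneg) auto
  have E30: "E3 \<ge> 0" unfolding E3_def by (intro sum_nonneg) auto
  have r1: "1 \<le> r s" if "s \<in> f ` (B \<times> B)" for s
    unfolding r_def using that fin by (intro fibre_card_pos) auto
  have r2: "r s < 2 ^ m" for s
    using fibre_card_le_card[of "B \<times> B" f s] fin mB unfolding r_def by simp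
  have "\<exists>j. (\<Sum>s\<in>f ` (B \<times> B). (real (r s))\<^sup>2) \<le>
     real m * (\<Sum>s | s \<in> f ` (B \<times> B) \<and> 2 ^ j \<le> r s \<and> r s < 2 * 2 ^ j. (real (r s))\<^sup>2)"
    by (rule dyadic_pigeonhole[OF _ r1 r2 m0]) (use fin in auto)
  then obtain j where j: "(\<Sum>s\<in>f ` (B \<times> B). (real (r s))\<^sup>2) \<le>
     real m * (\<Sum>s | s \<in> f ` (B \<times> B) \<and> 2 ^ j \<le> r s \<and> r s < 2 * 2 ^ j. (real (r s))\<^sup>2)" ..
  \<comment> \<open>\<open>P\<close> is the dyadic level of differences carrying the largest share
    of the energy of \<open>B\<close>; all of them have about \<open>\<tau>\<close>
    representations.\<close>
  define \<tau> P where "\<tau> = real ((2::nat) ^ j)" and "P = {s \<in> f ` (B \<times> B). 2 ^ j \<le> r s \<and> r s < 2 * 2 ^ j}"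
  define p where "p = real (card P)"
  have \<tau>: "\<tau> > 0" by (simp add: \<tau>_def)
  have p0: "p \<ge> 0" by (simp add: p_def)
  have finP: "finite P" using fin by (simp add: P_def)
  have P\<tau>: "\<tau> \<le> real (r s)" "real (r s) \<le> 2 * \<tau>" if "s \<in> P" for s
  proof -
    have "2 ^ j \<le> r s" "r s \<le> 2 * 2 ^ j" using that by (auto simp: P_def)
    then show "\<tau> \<le> real (r s)" "real (r s) \<le> 2 * \<tau>"
      unfolding \<tau>_def by (metis of_nat_le_iff, metis of_nat_le_iff of_nat_mult of_nat_numeral)
  qed
  have energy: "\<beta> ^ 4 \<le> 4 * \<sigma> * \<mu> * (\<tau>\<^sup>2 * p)"
  proof -
    let ?sm = "\<lambda>(b, c). b + c :: real"
    have "(\<Sum>v\<in>S. (real (fibre_card ?sm (B \<times> B) v))\<^sup>2) =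
       real (card {(p, q). p \<in> B \<times> B \<and> q \<in> B \<times> B \<and> ?sm p = ?sm q})"
      unfolding S_def using fin by (intro sum_fibre_card_square_eq_card) auto
    \<comment> \<open>Since a + b = c + d means a - c = d - b, sums and differences of
      \<open>B\<close> have the same energy.\<close>
    also have "card {(p, q). p \<in> B \<times> B \<and> q \<in> B \<times> B \<and> ?sm p = ?sm q}
       = card {(p, q). p \<in> B \<times> B \<and> q \<in> B \<times> B \<and> f p = f q}"
      by (rule bij_betw_same_card[of "\<lambda>((a, b), (c, d)). ((a, c), (d, b))"],
          rule bij_betwI[where g = "\<lambda>((a, c), (d, b)). ((a, b), (c, d))"])
        (auto simp: f_def algebra_simps)
    also have "real \<dots> = (\<Sum>s\<in>f ` (B \<times> B). (real (r s))\<^sup>2)"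
      unfolding r_def using fin by (intro sum_fibre_card_square_eq_card[symmetric]) auto
    also have "\<dots> \<le> \<mu> * (\<Sum>s\<in>P. (real (r s))\<^sup>2)" using j by (simp add: P_def \<mu>_def)
    finally have "(\<Sum>v\<in>S. (real (fibre_card ?sm (B \<times> B) v))\<^sup>2) \<le> \<mu> * (\<Sum>s\<in>P. (real (r s))\<^sup>2)" .
    moreover have "(\<Sum>s\<in>P. (real (r s))\<^sup>2) \<le> p * (2 * \<tau>)\<^sup>2"
      unfolding p_def using P\<tau> by (intro sum_bounded_above power_mono) auto
    then have "\<mu> * (\<Sum>s\<in>P. (real (r s))\<^sup>2) \<le> \<mu> * (p * (2 * \<tau>)\<^sup>2)"
      by (intro mult_left_mono) (auto simp: \<mu>_def)
    ultimately have "\<sigma> * (\<Sum>v\<in>S. (real (fibre_card ?sm (B \<times> B) v))\<^sup>2) \<le> \<sigma> * (\<mu> * (p * (2 * \<tau>)\<^sup>2))"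
      by (intro mult_left_mono) (auto simp: \<sigma>_def)
    moreover have "(real (card (B \<times> B)))\<^sup>2 \<le> \<sigma> * (\<Sum>v\<in>S. (real (fibre_card ?sm (B \<times> B) v))\<^sup>2)"
      unfolding \<sigma>_def S_def using fin by (intro card_square_le_energy) auto
    moreover have "(real (card (B \<times> B)))\<^sup>2 = \<beta> ^ 4"
      by (simp add: \<beta>_def card_cartesian_product power2_eq_square power4_eq_xxxx mult.assoc)
    ultimately have "\<beta> ^ 4 \<le> \<sigma> * (\<mu> * (p * (2 * \<tau>)\<^sup>2))" by linarith
    then show ?thesis by (simp add: power_mult_distrib mult_ac)
  qed
  have popular: "p * \<tau> ^ 3 \<le> M * \<beta>\<^sup>2"
  proof -
    have "card P \<le> card {x \<in> f ` (B \<times> B). 2 ^ j \<le> fibre_card f (B \<times> B) x}"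
      using fin by (intro card_mono) (auto simp: P_def r_def)
    then have "p * \<tau> ^ 3 \<le> real (card {x \<in> f ` (B \<times> B). 2 ^ j \<le> fibre_card f (B \<times> B) x}) * \<tau> ^ 3"
      unfolding p_def using \<tau> by (intro mult_right_mono) auto
    also have "\<dots> \<le> M * (real (card B))\<^sup>2" unfolding \<tau>_def by (rule rich[OF fin]) simp
    finally show ?thesis by (simp add: \<beta>_def)
  qed
  have key: "(\<beta> * \<tau> * p)\<^sup>2 * \<tau> \<le> E3 * W"
  proof -
    define Bs where "Bs s = {b \<in> B. b - s \<in> B}" for s
    define R where "R s = real (card {y \<in> S. y - s \<in> S})" for s
    define E where "E s = (\<Sum>v\<in>(\<lambda>(x, y). x + y) ` (B \<times> Bs s). (real (fibre_card (\<lambda>(x, y). x + y) (B \<times> Bs s) v))\<^sup>2)" for s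
    have E0: "E s \<ge> 0" for s unfolding E_def by (intro sum_nonneg) auto
    have R0: "R s \<ge> 0" for s by (simp add: R_def)
    have *: "\<beta> * \<tau> \<le> sqrt (E s) * sqrt (R s)" if "s \<in> P" for s
    proof -
      have finBs: "finite (Bs s)" using fin by (simp add: Bs_def)
      have "r s = card (Bs s)" unfolding r_def fibre_card_def
        by (rule bij_betw_same_card[of fst], rule bij_betwI[where g = "\<lambda>b. (b, b - s)"])
          (auto simp: f_def Bs_def)
      then have "\<tau> \<le> real (card (Bs s))" using P\<tau>[OF that] by simp
      then have "(\<beta> * \<tau>)\<^sup>2 \<le> (real (card (B \<times> Bs s)))\<^sup>2"
        using \<beta> \<tau> by (intro power_mono) (auto simp: \<beta>_def card_cartesian_product)
      also have "\<dots> \<le> real (card ((\<lambda>(x, y). x + y) ` (B \<times> Bs s))) * E s"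
        unfolding E_def using fin finBs by (intro card_square_le_energy) auto
      also have "card ((\<lambda>(x, y). x + y) ` (B \<times> Bs s)) \<le> card {y \<in> S. y - s \<in> S}"
      proof (rule card_mono)
        show "(\<lambda>(x, y). x + y) ` (B \<times> Bs s) \<subseteq> {y \<in> S. y - s \<in> S}"
          by (force simp: S_def Bs_def algebra_simps)
      qed (use finS in simp)
      then have "real (card ((\<lambda>(x, y). x + y) ` (B \<times> Bs s))) * E s \<le> R s * E s"
        using E0 by (intro mult_right_mono) (auto simp: R_def)
      finally have "(\<beta> * \<tau>)\<^sup>2 \<le> E s * R s" by (simp add: mult.commute)
      then show ?thesis by (simp add: real_le_rsqrt flip: real_sqrt_mult)
    qed
    have "\<beta> * \<tau> * p = (\<Sum>s\<in>P. \<beta> * \<tau>)" by (simp add: p_def)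
    also have "\<dots> \<le> (\<Sum>s\<in>P. sqrt (E s) * sqrt (R s))" using * by (intro sum_mono)
    finally have "(\<beta> * \<tau> * p)\<^sup>2 \<le> (\<Sum>s\<in>P. sqrt (E s) * sqrt (R s))\<^sup>2"
      using \<beta> \<tau> p0 by (intro power_mono) auto
    also have "\<dots> \<le> (\<Sum>s\<in>P. (sqrt (E s))\<^sup>2) * (\<Sum>s\<in>P. (sqrt (R s))\<^sup>2)" by (rule Cauchy_Schwarz_ineq_sum)
    also have "\<dots> = (\<Sum>s\<in>P. E s) * (\<Sum>s\<in>P. R s)" using E0 R0 by simp
    also have "\<dots> \<le> E3 * (\<Sum>s\<in>P. R s)"
    proof (intro mult_right_mono sum_nonneg R0)
      show "(\<Sum>s\<in>P. E s) \<le> E3"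
        unfolding E_def E3_def Bs_def f_def by (rule sum_energy_translates_le[OF fin finP])
    qed
    \<comment> \<open>The extra factor \<open>\<tau>\<close> is replaced by the representation count
      of \<open>s\<close>, which makes the sum of \<open>R s\<close> comparable to
      \<open>W\<close>.\<close>
    finally have "(\<beta> * \<tau> * p)\<^sup>2 * \<tau> \<le> E3 * (\<Sum>s\<in>P. R s) * \<tau>"
      using \<tau> by (intro mult_right_mono) auto
    also have "\<dots> = E3 * (\<Sum>s\<in>P. \<tau> * R s)" by (simp add: sum_distrib_left mult_ac)
    also have "\<dots> \<le> E3 * (\<Sum>s\<in>P. real (r s) * R s)"
      using P\<tau> E30 R0 by (intro mult_left_mono sum_mono mult_right_mono) auto
    also have "\<dots> \<le> E3 * W"
      unfolding R_def r_def W_def f_def using E30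
      by (intro mult_left_mono sum_fibre_card_mult_translates_le fin finP finS)
    finally show ?thesis .
  qed
  \<comment> \<open>Up to constants, \<open>U\<close> is the energy of \<open>B\<close> on the level
    \<open>P\<close>.\<close>
  define U where "U = \<tau>\<^sup>2 * p"
  have U0: "U \<ge> 0" using p0 by (simp add: U_def)
  have "\<beta> ^ 4 * U ^ 4 = \<tau>\<^sup>2 * ((\<beta> * \<tau> * p)\<^sup>2 * \<tau>)\<^sup>2"
    unfolding U_def by algebra
  also have "\<dots> \<le> \<tau>\<^sup>2 * (E3 * W)\<^sup>2"
    using key \<tau> by (intro mult_left_mono power_mono) auto
  also have "\<dots> = \<tau>\<^sup>2 * (E3\<^sup>2 * W\<^sup>2)" by (simp add: power_mult_distrib)
  also have "\<dots> \<le> \<tau>\<^sup>2 * ((8 * \<mu> * (M * \<beta>\<^sup>2))\<^sup>2 * (8 * \<mu>\<^sup>2 * M * \<beta> * \<sigma> ^ 3))"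
    using E3 E30 W by (intro mult_left_mono mult_mono power_mono) auto
  also have "\<dots> = \<beta> ^ 4 * (512 * \<tau>\<^sup>2 * \<mu> ^ 4 * M ^ 3 * \<beta> * \<sigma> ^ 3)"
    by algebra
  finally have U4: "U ^ 4 \<le> 512 * \<tau>\<^sup>2 * \<mu> ^ 4 * M ^ 3 * \<beta> * \<sigma> ^ 3"
    using \<beta> by (simp only: mult_le_cancel_left_pos zero_less_power)
  have \<sigma>0: "\<sigma> \<ge> 0" "\<mu> \<ge> 0" by (simp_all add: \<sigma>_def \<mu>_def)
  \<comment> \<open>The bound \<open>U4\<close> still contains the unknown level
    \<open>\<tau>\<close>. Multiplying by the square of \<open>U\<close> completes it to the square
    of p \<tau>^3, which \<open>popular\<close> bounds.\<close>
  have "U ^ 6 = U ^ 4 * U\<^sup>2" by (simp flip: power_add)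
  also have "\<dots> \<le> 512 * \<tau>\<^sup>2 * \<mu> ^ 4 * M ^ 3 * \<beta> * \<sigma> ^ 3 * U\<^sup>2"
    using U4 by (intro mult_right_mono) auto
  also have "\<dots> = 512 * \<mu> ^ 4 * M ^ 3 * \<beta> * \<sigma> ^ 3 * (p * \<tau> ^ 3)\<^sup>2"
    unfolding U_def by algebra
  also have "\<dots> \<le> 512 * \<mu> ^ 4 * M ^ 3 * \<beta> * \<sigma> ^ 3 * (M * \<beta>\<^sup>2)\<^sup>2"
    using popular p0 \<tau> M \<beta> \<sigma>0 by (intro mult_left_mono power_mono) auto
  also have "\<dots> = 512 * \<mu> ^ 4 * M ^ 5 * \<beta> ^ 5 * \<sigma> ^ 3" by algebra
  finally have U6: "U ^ 6 \<le> 512 * \<mu> ^ 4 * M ^ 5 * \<beta> ^ 5 * \<sigma> ^ 3" .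
  \<comment> \<open>The sixth power of \<open>energy\<close> meets \<open>U6\<close>; the constant
    is 4^6 * 512 = 2^21.\<close>
  have "\<beta> ^ 5 * \<beta> ^ 19 = (\<beta> ^ 4) ^ 6" by (simp flip: power_add power_mult)
  also have "\<dots> \<le> (4 * \<sigma> * \<mu> * U) ^ 6" using energy unfolding U_def by (intro power_mono) auto
  also have "\<dots> = 4096 * \<sigma> ^ 6 * \<mu> ^ 6 * U ^ 6" by (simp add: power_mult_distrib)
  also have "\<dots> \<le> 4096 * \<sigma> ^ 6 * \<mu> ^ 6 * (512 * \<mu> ^ 4 * M ^ 5 * \<beta> ^ 5 * \<sigma> ^ 3)"
    using U6 \<sigma>0 by (intro mult_left_mono) auto
  also have "\<dots> = \<beta> ^ 5 * (2 ^ 21 * \<mu> ^ 10 * \<sigma> ^ 9 * M ^ 5)"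
    by algebra
  finally show ?thesis
    using \<beta> unfolding \<mu>_def \<beta>_def \<sigma>_def by (simp only: mult_le_cancel_left_pos zero_less_power)
qed

section \<open>The growth of A(A+A)\<close>

lemma finite_prod_sum_set: "finite A \<Longrightarrow> finite (prod_sum_set A)"
proof -
  assume "finite A"
  moreover have "prod_sum_set A = (\<lambda>(a, b, c). a * (b + c)) ` (A \<times> A \<times> A)"
    by (force simp: prod_sum_set_def)
  ultimately show ?thesis by simp
qed

text \<open>Multiplication by one nonzero element of \<open>A\<close> embeds B + B into
  A(A+A).\<close>

lemma card_sumset_le_prod_sum_set:
  assumes fin: "finite A" and a: "a \<in> A" "a \<noteq> 0" and B: "B \<subseteq> A"
  shows "card ((\<lambda>(b, c). b + c) ` (B \<times> B)) \<le> card (prod_sum_set A)"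
proof (rule card_inj_on_le)
  show "inj_on (\<lambda>x. a * x) ((\<lambda>(b, c). b + c) ` (B \<times> B))" using a by (simp add: inj_on_def)
  show "(\<lambda>x. a * x) ` (\<lambda>(b, c). b + c) ` (B \<times> B) \<subseteq> prod_sum_set A"
    using a B by (auto simp: prod_sum_set_def)
qed (use fin in \<open>rule finite_prod_sum_set\<close>)

lemma card_le_prod_sum_set:
  assumes "finite A" "a \<in> A" "a \<noteq> 0"
  shows "card A \<le> card (prod_sum_set A)"
proof (rule card_inj_on_le)
  show "inj_on (\<lambda>x. a * (a + x)) A" using assms by (simp add: inj_on_def)
  show "(\<lambda>x. a * (a + x)) ` A \<subseteq> prod_sum_set A"
    using assms by (auto simp: prod_sum_set_def)
qed (use assms in \<open>simp add: finite_prod_sum_set\<close>)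

text \<open>Double counting of the pairs (b, a) with b / a in \<open>T\<close>: by ratio there are
  at least \<rho> |T|, by numerator they number the sum of the degrees of the b. Pigeonholing the
  degrees yields \<open>B\<close> and \<open>q\<close>.\<close>

lemma rich_subset:
  fixes A T :: "real set"
  assumes fin: "finite A" and ne: "A \<noteq> {}" and m: "card A ^ 4 < 2 ^ m"
    and T: "T \<subseteq> (\<lambda>(a, a'). a / a') ` (A \<times> A)" "\<forall>t\<in>T. \<rho> \<le> fibre_card (\<lambda>(a, a'). a / a') (A \<times> A) t"
  obtains B and q :: nat where "1 \<le> q" "B \<subseteq> A" "\<forall>b\<in>B. q \<le> card {a \<in> A. b / a \<in> T}"
    "real \<rho> * real (card T) \<le> 2 * real m * real q * real (card B)"
    "real \<rho> * real (card T) \<le> (real (card A))\<^sup>2"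
proof -
  let ?\<phi> = "\<lambda>(a, a'). a / a' :: real" and ?W = "A \<times> A"
  define deg where "deg b = card {a \<in> A. b / a \<in> T}" for b
  \<comment> \<open>Elements of degree zero add nothing to the sum and belong to no dyadic
    level.\<close>
  define X where "X = {b \<in> A. 1 \<le> deg b}"
  have m0: "m > 0" using m ne fin by (cases m) (auto simp: card_gt_0_iff)
  have finT: "finite T" by (rule finite_subset[OF T(1)]) (use fin in simp)
  have "card T * \<rho> = (\<Sum>t\<in>T. \<rho>)" by simp
  also have "\<dots> \<le> (\<Sum>t\<in>T. fibre_card ?\<phi> ?W t)" using T(2) by (intro sum_mono) auto
  finally have 1: "card T * \<rho> \<le> (\<Sum>t\<in>T. fibre_card ?\<phi> ?W t)" .
  have "(\<Sum>t\<in>T. fibre_card ?\<phi> ?W t) = card (\<Union>t\<in>T. {x \<in> ?W. ?\<phi> x = t})"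
    unfolding fibre_card_def using finT fin by (intro card_UN_disjoint[symmetric]) auto
  also have "(\<Union>t\<in>T. {x \<in> ?W. ?\<phi> x = t}) = Sigma A (\<lambda>b. {a \<in> A. b / a \<in> T})" by auto
  also have "card \<dots> = (\<Sum>b\<in>A. deg b)" unfolding deg_def using fin by (intro card_SigmaI) auto
  finally have 2: "(\<Sum>t\<in>T. fibre_card ?\<phi> ?W t) = (\<Sum>b\<in>A. deg b)" .
  have degA: "deg b \<le> card A" for b unfolding deg_def using fin by (intro card_mono) auto
  then have "(\<Sum>b\<in>A. deg b) \<le> card A * card A" using sum_bounded_above[of A deg "card A"] by simp
  with 1 2 have "card T * \<rho> \<le> card A * card A" by simp
  then have "real (card T * \<rho>) \<le> real (card A * card A)" by (rule of_nat_mono)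
  then have le2: "real \<rho> * real (card T) \<le> (real (card A))\<^sup>2" by (simp add: power2_eq_square mult.commute)
  have X1: "1 \<le> deg b" if "b \<in> X" for b using that by (simp add: X_def)
  have X2: "deg b < 2 ^ m" if "b \<in> X" for b
  proof -
    have "card A \<le> card A ^ 4" using ne fin by (intro self_le_power) (auto simp: Suc_le_eq card_gt_0_iff)
    then show ?thesis using degA[of b] m by linarith
  qed
  have "\<exists>j. (\<Sum>b\<in>X. real (deg b)) \<le> real m * (\<Sum>b | b \<in> X \<and> 2 ^ j \<le> deg b \<and> deg b < 2 * 2 ^ j. real (deg b))"
    by (rule dyadic_pigeonhole[OF _ X1 X2 m0]) (use fin in \<open>auto simp: X_def\<close>)
  then obtain j where j: "(\<Sum>b\<in>X. real (deg b)) \<le>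
      real m * (\<Sum>b | b \<in> X \<and> 2 ^ j \<le> deg b \<and> deg b < 2 * 2 ^ j. real (deg b))" ..
  define B where "B = {b \<in> X. 2 ^ j \<le> deg b \<and> deg b < 2 * 2 ^ j}"
  define q :: nat where "q = 2 ^ j"
  have degq: "real (deg b) \<le> 2 * real q" if "b \<in> B" for b
  proof -
    have "deg b \<le> 2 * q" using that by (simp add: B_def q_def)
    then have "real (deg b) \<le> real (2 * q)" by (rule of_nat_mono)
    then show ?thesis by simp
  qed
  have "real \<rho> * real (card T) = real (card T * \<rho>)" by simp
  also have "\<dots> \<le> real (\<Sum>b\<in>A. deg b)" using 1 unfolding 2 by (rule of_nat_mono)
  also have "(\<Sum>b\<in>A. deg b) = (\<Sum>b\<in>X. deg b)"
    using fin by (intro sum.mono_neutral_right) (auto simp: X_def not_le)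
  also have "real (\<Sum>b\<in>X. deg b) \<le> real m * (\<Sum>b\<in>B. real (deg b))" using j by (simp add: B_def)
  also have "\<dots> \<le> real m * (real (card B) * (2 * real q))"
    using degq by (intro mult_left_mono sum_bounded_above) auto
  finally have "real \<rho> * real (card T) \<le> 2 * real m * real q * real (card B)" by (simp add: mult_ac)
  then show ?thesis using le2 by (intro that[of q B]) (auto simp: q_def B_def X_def deg_def)
qed

text \<open>Write r for \<rho> and \<tau> for |T|. Up to constants and powers of \<open>m\<close>,
  N^6 is at most s^2 r^2 \<tau>, while the sumset bound for \<open>B\<close> with |B + B| \<le> s
  limits r^2 \<tau> from above. Eliminating r, \<tau>, q and |B| leaves a relation between N and s
  alone.\<close>

lemma prod_sum_set_positive:
  fixes A :: "real set"
  assumes fin: "finite A" and ne: "A \<noteq> {}" and pos: "\<And>a. a \<in> A \<Longrightarrow> a > 0" and m: "card A ^ 4 < 2 ^ m"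
  shows "real (card A) ^ 44 \<le> 2 ^ 180 * real m ^ 69 * real (card (prod_sum_set A)) ^ 29"
proof -
  define N s where "N = real (card A)" and "s = real (card (prod_sum_set A))"
  obtain \<rho> T where \<rho>: "1 \<le> \<rho>" and T: "T \<subseteq> (\<lambda>(a, a'). a / a') ` (A \<times> A)"
    "\<forall>t\<in>T. \<rho> \<le> fibre_card (\<lambda>(a, a'). a / a') (A \<times> A) t"
    and E1: "N ^ 6 \<le> 2048 * s\<^sup>2 * real m ^ 4 * (real \<rho>)\<^sup>2 * real (card T)"
    unfolding N_def s_def by (rule popular_ratios[OF fin pos ne m])
  obtain B q where q: "1 \<le> q" and B: "B \<subseteq> A" "\<forall>b\<in>B. q \<le> card {a \<in> A. b / a \<in> T}"
    and qB: "real \<rho> * real (card T) \<le> 2 * real m * real q * real (card B)"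
    and \<rho>T: "real \<rho> * real (card T) \<le> N\<^sup>2"
    unfolding N_def by (rule rich_subset[OF fin ne m T])
  define \<tau> r Q \<beta> \<mu> where "\<tau> = real (card T)" and "r = real \<rho>" and "Q = real q" and "\<beta> = real (card B)" and "\<mu> = real m"
  have N: "N > 0" using fin ne by (simp add: N_def card_gt_0_iff)
  have finT: "finite T" by (rule finite_subset[OF T(1)]) (use fin in simp)
  have finB: "finite B" using B(1) fin by (rule finite_subset)
  have Tpos: "t > 0" if "t \<in> T" for t using that T(1) pos by fastforce
  have \<tau>: "\<tau> > 0"
  proof -
    have "N ^ 6 > 0" using N by simp
    with E1 have "\<tau> \<noteq> 0" by (intro notI) (simp add: \<tau>_def)
    then show ?thesis by (simp add: \<tau>_def)
  qed
  have rQ: "r > 0" "Q > 0" "\<mu> \<ge> 0" "s \<ge> 0" "\<beta> \<ge> 0" using \<rho> q by (simp_all add: r_def Q_def \<mu>_def s_def \<beta>_def)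
  have Bne: "B \<noteq> {}"
  proof
    assume "B = {}"
    then have "r * \<tau> \<le> 0" using qB by (simp add: r_def \<tau>_def)
    moreover have "r * \<tau> > 0" using rQ \<tau> by simp
    ultimately show False by simp
  qed
  obtain b where b: "b \<in> B" using Bne by auto
  have QN: "Q \<le> N"
  proof -
    have "card {a \<in> A. b / a \<in> T} \<le> card A" using fin by (intro card_mono) auto
    then show ?thesis using bspec[OF B(2) b] by (simp add: Q_def N_def)
  qed
  define S where "S = (\<lambda>(b, c). b + c) ` (B \<times> B)"
  \<comment> \<open>This is the constant that \<open>popular_differences_le\<close> supplies after
    division by q^3.\<close>
  define M where "M = 64 * N\<^sup>2 * \<tau>\<^sup>2 / Q ^ 3"
  have "card S \<le> card (prod_sum_set A)"
    unfolding S_def using b B(1) pos by (intro card_sumset_le_prod_sum_set[OF fin, of b]) force+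
  then have Ss: "real (card S) \<le> s" by (simp add: s_def)
  have "real (card B) ^ 19 \<le> 2 ^ 21 * real m ^ 10 * real (card S) ^ 9 * M ^ 5"
    unfolding S_def
  proof (rule card_sumset_ge[OF finB Bne])
    have BA: "card B \<le> card A" using B(1) fin by (intro card_mono)
    have "card ((\<lambda>(b, c). b + c) ` (B \<times> B)) \<le> card (B \<times> B)" using finB by (intro card_image_le) simp
    then have "card B * card ((\<lambda>(b, c). b + c) ` (B \<times> B)) \<le> card B * (card B * card B)"
      by (simp add: card_cartesian_product)
    also have "\<dots> \<le> card A * (card A * card A)" using BA by (intro mult_le_mono)
    also have "\<dots> = card A ^ 3" by (simp add: power3_eq_cube)
    also have "\<dots> \<le> card A ^ 4" using ne fin by (intro power_increasing) (auto simp: Suc_le_eq card_gt_0_iff)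
    finally show "card B * card ((\<lambda>(b, c). b + c) ` (B \<times> B)) < 2 ^ m" using m by simp
  next
    fix C :: "real set" and k :: nat
    assume "finite C" "1 \<le> k"
    from popular_differences_le[OF fin finT this(1) pos Tpos B(1) bspec[OF B(2)] this(2)]
    show "real (card {x \<in> (\<lambda>(b, c). b - c) ` (B \<times> C). k \<le> fibre_card (\<lambda>(b, c). b - c) (B \<times> C) x}) * real k ^ 3
       \<le> M * (real (card C))\<^sup>2"
      using rQ by (simp add: M_def N_def \<tau>_def Q_def field_simps)
  qed
  also have "\<dots> \<le> 2 ^ 21 * real m ^ 10 * s ^ 9 * M ^ 5"
    using Ss by (intro mult_left_mono mult_right_mono power_mono) (auto simp: M_def Q_def)
  finally have "\<beta> ^ 19 * Q ^ 15 \<le> 2 ^ 21 * \<mu> ^ 10 * s ^ 9 * M ^ 5 * Q ^ 15"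
    unfolding \<beta>_def \<mu>_def using rQ by (intro mult_right_mono) auto
  also have "\<dots> = 2 ^ 21 * \<mu> ^ 10 * s ^ 9 * (M * Q ^ 3) ^ 5" by algebra
  also have "M * Q ^ 3 = 64 * N\<^sup>2 * \<tau>\<^sup>2" using rQ by (simp add: M_def)
  also have "2 ^ 21 * \<mu> ^ 10 * s ^ 9 * (64 * N\<^sup>2 * \<tau>\<^sup>2) ^ 5 = 2 ^ 51 * \<mu> ^ 10 * s ^ 9 * N ^ 10 * \<tau> ^ 10" by algebra
  finally have \<beta>Q: "\<beta> ^ 19 * Q ^ 15 \<le> 2 ^ 51 * \<mu> ^ 10 * s ^ 9 * N ^ 10 * \<tau> ^ 10" .
  \<comment> \<open>The exponent 19 matches |B|^19 in \<open>\<beta>Q\<close>. Of the 19 factors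
    \<open>Q\<close>, 15 are absorbed there and the other four are bounded by
    \<open>N\<close>.\<close>
  have "\<tau> ^ 10 * (r ^ 19 * \<tau> ^ 9) = (r * \<tau>) ^ 19" by algebra
  also have "\<dots> \<le> (2 * \<mu> * Q * \<beta>) ^ 19"
    using qB rQ \<tau> by (intro power_mono) (auto simp: r_def \<tau>_def \<mu>_def Q_def \<beta>_def)
  also have "\<dots> = 2 ^ 19 * \<mu> ^ 19 * (\<beta> ^ 19 * Q ^ 15) * Q ^ 4" by algebra
  also have "\<dots> \<le> 2 ^ 19 * \<mu> ^ 19 * (2 ^ 51 * \<mu> ^ 10 * s ^ 9 * N ^ 10 * \<tau> ^ 10) * N ^ 4"
    by (intro mult_mono[OF mult_left_mono[OF \<beta>Q] power_mono[OF QN]]) (use rQ N \<tau> in auto)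
  also have "\<dots> = \<tau> ^ 10 * (2 ^ 70 * \<mu> ^ 29 * s ^ 9 * N ^ 14)" by algebra
  finally have r19: "r ^ 19 * \<tau> ^ 9 \<le> 2 ^ 70 * \<mu> ^ 29 * s ^ 9 * N ^ 14"
    by (rule mult_left_le_imp_le) (use \<tau> in simp)
  \<comment> \<open>One more factor r \<tau> \<le> N^2 completes the tenth power of the quantity
    that occurs in \<open>E1\<close>.\<close>
  have "(r\<^sup>2 * \<tau>) ^ 10 = r ^ 19 * \<tau> ^ 9 * (r * \<tau>)" by algebra
  also have "\<dots> \<le> (2 ^ 70 * \<mu> ^ 29 * s ^ 9 * N ^ 14) * N\<^sup>2"
    by (rule mult_mono[OF r19 \<rho>T[folded r_def \<tau>_def]]) (use rQ \<tau> N in auto)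
  finally have V: "(r\<^sup>2 * \<tau>) ^ 10 \<le> 2 ^ 70 * \<mu> ^ 29 * s ^ 9 * N ^ 14 * N\<^sup>2" .
  have "N ^ 16 * N ^ 44 = (N ^ 6) ^ 10" by algebra
  also have "\<dots> \<le> (2048 * s\<^sup>2 * \<mu> ^ 4 * (r\<^sup>2 * \<tau>)) ^ 10"
    using E1 N by (intro power_mono) (auto simp: \<mu>_def r_def \<tau>_def mult.assoc)
  also have "\<dots> = 2 ^ 110 * s ^ 20 * \<mu> ^ 40 * (r\<^sup>2 * \<tau>) ^ 10" by algebra
  also have "\<dots> \<le> 2 ^ 110 * s ^ 20 * \<mu> ^ 40 * (2 ^ 70 * \<mu> ^ 29 * s ^ 9 * N ^ 14 * N\<^sup>2)"
    using V rQ by (intro mult_left_mono) auto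
  also have "\<dots> = N ^ 16 * (2 ^ 180 * \<mu> ^ 69 * s ^ 29)" by algebra
  finally have "N ^ 44 \<le> 2 ^ 180 * \<mu> ^ 69 * s ^ 29"
    by (rule mult_left_le_imp_le) (use N in simp)
  then show ?thesis by (simp add: N_def \<mu>_def s_def)
qed

section \<open>Reduction to positive sets and the final exponents\<close>

text \<open>As (-a)((-b) + (-c)) = a (b + c), the negative part can be reflected without leaving
  A(A+A). The larger of the two parts has at least (|A| - 1) / 2 elements, which is at least |A| / 4
  because |A| \<ge> 2.\<close>

lemma obtain_positive_part:
  fixes A :: "real set"
  assumes fin: "finite A" and A: "2 \<le> card A"
  obtains P where "finite P" "P \<noteq> {}" "\<forall>a\<in>P. a > 0" "card A \<le> 4 * card P" "card P \<le> card A"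
    "card (prod_sum_set P) \<le> card (prod_sum_set A)"
proof -
  define U V where "U = {a \<in> A. a > 0}" and "V = {a \<in> A. a < 0}"
  have fUV: "finite U" "finite V" using fin by (auto simp: U_def V_def)
  have "A \<subseteq> insert 0 (U \<union> V)" by (auto simp: U_def V_def)
  then have "card A \<le> card (insert 0 (U \<union> V))" using fUV by (intro card_mono) auto
  also have "\<dots> \<le> Suc (card (U \<union> V))" using fUV by (simp add: card_insert_if)
  also have "\<dots> \<le> Suc (card U + card V)" by (simp add: card_Un_le)
  finally have cA: "card A \<le> 1 + card U + card V" by simp
  have sub: "card U \<le> card A" "card V \<le> card A" using fin by (auto simp: U_def V_def intro: card_mono)
  show ?thesis
  proof (cases "card V \<le> card U")
    case True
    have "prod_sum_set U \<subseteq> prod_sum_set A" by (auto simp: prod_sum_set_def U_def)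
    then have "card (prod_sum_set U) \<le> card (prod_sum_set A)"
      using fin by (intro card_mono finite_prod_sum_set)
    moreover have "U \<noteq> {}" using True cA A by auto
    ultimately show ?thesis using True cA A sub fUV by (intro that[of U]) (auto simp: U_def)
  next
    case False
    have cV: "card (uminus ` V) = card V" by (intro card_image) (auto simp: inj_on_def)
    have "prod_sum_set (uminus ` V) \<subseteq> prod_sum_set A"
    proof
      fix x assume "x \<in> prod_sum_set (uminus ` V)"
      then obtain a b c where "a \<in> V" "b \<in> V" "c \<in> V" "x = (- a) * (- b + - c)"
        by (auto simp: prod_sum_set_def)
      then have "a \<in> A" "b \<in> A" "c \<in> A" "x = a * (b + c)" by (auto simp: V_def algebra_simps)
      then show "x \<in> prod_sum_set A" by (auto simp: prod_sum_set_def)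
    qed
    then have "card (prod_sum_set (uminus ` V)) \<le> card (prod_sum_set A)"
      using fin by (intro card_mono finite_prod_sum_set)
    moreover have "V \<noteq> {}" using False by auto
    ultimately show ?thesis using False cA A sub fUV cV
      by (intro that[of "uminus ` V"]) (auto simp: V_def)
  qed
qed

lemma prod_sum_set_power_bound:
  fixes A :: "real set"
  assumes fin: "finite A" and A: "2 \<le> card A"
  defines "s \<equiv> real (card (prod_sum_set A))"
  shows "real (card A) ^ 44 \<le> 2 ^ 475 * log 2 s ^ 69 * s ^ 29" and "log 2 s \<ge> 1"
proof -
  obtain P where P: "finite P" "P \<noteq> {}" "\<forall>a\<in>P. a > 0" and cP: "card A \<le> 4 * card P" "card P \<le> card A"
    and sP: "card (prod_sum_set P) \<le> card (prod_sum_set A)"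
    by (rule obtain_positive_part[OF fin A])
  have "\<exists>a\<in>A. a \<noteq> 0"
  proof (rule ccontr)
    assume "\<not> ?thesis"
    then have "A \<subseteq> {0}" by auto
    then have "card A \<le> card {0::real}" by (intro card_mono) auto
    then show False using A by simp
  qed
  then have As: "card A \<le> card (prod_sum_set A)" using card_le_prod_sum_set[OF fin] by blast
  then have s2: "s \<ge> 2" using A by (simp add: s_def)
  then show l1: "log 2 s \<ge> 1" by (simp add: le_log_iff)
  define N where "N = real (card P)"
  have N1: "N \<ge> 1" using P by (simp add: N_def Suc_le_eq card_gt_0_iff)
  have Ns: "N \<le> s" using cP As by (simp add: N_def s_def)
  \<comment> \<open>The added 1 makes N^4 < 2^m strict even when 4 log N is an integer.\<close>
  define m where "m = nat \<lfloor>4 * log 2 N\<rfloor> + 1"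
  have lN: "log 2 N \<ge> 0" using N1 by simp
  have m4: "4 * log 2 N < real m" and mle: "real m \<le> 4 * log 2 N + 1"
    using lN by (simp_all add: m_def; linarith)+
  have "N ^ 4 = 2 powr (4 * log 2 N)"
    using N1 by (simp add: mult.commute[of 4] powr_powr[symmetric])
  also have "\<dots> < 2 powr real m" using m4 by simp
  also have "\<dots> = 2 ^ m" by (simp add: powr_realpow)
  finally have "real (card P ^ 4) < real (2 ^ m)" by (simp add: N_def)
  then have "card P ^ 4 < 2 ^ m" by (rule of_nat_less_imp_less)
  then have "N ^ 44 \<le> 2 ^ 180 * real m ^ 69 * real (card (prod_sum_set P)) ^ 29"
    unfolding N_def using P by (intro prod_sum_set_positive) auto
  also have "\<dots> \<le> 2 ^ 180 * (8 * log 2 s) ^ 69 * s ^ 29"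
  proof -
    have "log 2 N \<le> log 2 s" using N1 Ns by simp
    \<comment> \<open>The additive 1 is absorbed because log s \<ge> 1. The factor 8 keeps the
      constant a power of two: 88 + 180 + 3 * 69 = 475.\<close>
    then have "real m \<le> 8 * log 2 s" using mle l1 by linarith
    then show ?thesis using sP l1 by (intro mult_mono power_mono) (auto simp: s_def)
  qed
  finally have "4 ^ 44 * N ^ 44 \<le> 4 ^ 44 * (2 ^ 180 * (8 * log 2 s) ^ 69 * s ^ 29)"
    by (rule mult_left_mono) simp
  moreover have "real (card A) ^ 44 \<le> (4 * N) ^ 44" using cP by (intro power_mono) (auto simp: N_def)
  moreover have "4 ^ 44 * (2 ^ 180 * (8 * log 2 s) ^ 69 * s ^ 29) = 2 ^ 475 * log 2 s ^ 69 * s ^ 29"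
    by (simp add: power_mult_distrib)
  ultimately show "real (card A) ^ 44 \<le> 2 ^ 475 * log 2 s ^ 69 * s ^ 29" by (simp only: power_mult_distrib)
qed

theorem theorem2p6:
  shows "\<exists>C c :: real. C > 0 \<and> c > 0 \<and>
    (\<forall>A :: real set. finite A \<longrightarrow>
      real (card (prod_sum_set A)) \<ge>
        c * real (card A) powr (3/2 + 1/178)
          / (log 2 (real (card (prod_sum_set A)))) powr C)"
proof (intro exI conjI allI impI)
  fix A :: "real set" assume fin: "finite A"
  define n s l where "n = real (card A)" and "s = real (card (prod_sum_set A))" and "l = log 2 s"
  \<comment> \<open>Taking the 29th root of the power bound: 17 and 3 are 475 / 29 and 69 / 29
    rounded up, so the exponents grow to 493 = 17 * 29 and 87 = 3 * 29.\<close>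
  have "(1 / 2 ^ 17) * n powr (3/2 + 1/178) / l powr 3 \<le> s"
  proof (cases "2 \<le> card A")
    case True
    have n: "n \<ge> 1" using True by (simp add: n_def)
    have l: "l \<ge> 1" and le: "n ^ 44 \<le> 2 ^ 475 * l ^ 69 * s ^ 29"
      unfolding l_def s_def n_def using prod_sum_set_power_bound[OF fin True] by simp_all
    have l3: "l powr 3 = l ^ 3" using l by simp
    have "(n powr (3/2 + 1/178)) ^ 29 = n powr (29 * (3/2 + 1/178))"
      using n by (simp add: powr_power mult.commute)
    \<comment> \<open>Here 44 / 29 exceeds 3/2 + 1/178.\<close>
    also have "\<dots> \<le> n powr real 44" using n by (intro powr_mono) auto
    also have "\<dots> = n ^ 44" using n by (subst powr_realpow) auto
    also note le
    also have "2 ^ 475 * l ^ 69 * s ^ 29 \<le> 2 ^ 493 * l ^ 87 * s ^ 29"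
      using l by (intro mult_right_mono mult_mono power_increasing) (auto simp: s_def)
    also have "\<dots> = (2 ^ 17 * l ^ 3 * s) ^ 29" by (simp only: power_mult_distrib flip: power_mult) simp
    finally have "(n powr (3/2 + 1/178)) ^ 29 \<le> (2 ^ 17 * l ^ 3 * s) ^ 29" .
    then have "n powr (3/2 + 1/178) \<le> 2 ^ 17 * l ^ 3 * s"
      by (subst (asm) power_mono_iff) (use l in \<open>auto simp: s_def\<close>)
    then show ?thesis using l unfolding l3 by (simp add: field_simps)
  next
    case False
    then consider "card A = 0" | "card A = 1" by linarith
    then show ?thesis
    proof cases
      case 1
      then show ?thesis by (simp add: n_def s_def)
    next
      case 2
      then obtain a where "A = {a}" by (auto simp: card_1_singleton_iff)
      then have "prod_sum_set A = {a * (a + a)}" by (auto simp: prod_sum_set_def)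
      \<comment> \<open>A singleton gives log 1 = 0, so the quotient is a division by zero, whose
        value is 0.\<close>
      then have "l = 0" "s = 1" by (simp_all add: l_def s_def)
      then show ?thesis by simp
    qed
  qed
  then show "real (card (prod_sum_set A)) \<ge>
        (1 / 2 ^ 17) * real (card A) powr (3/2 + 1/178)
          / (log 2 (real (card (prod_sum_set A)))) powr 3"
    by (simp add: n_def s_def l_def)
qed auto

end
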